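(* There exist universal constants $c_0,c_1,C>0$ such that the following holds. For every $n\ge 1$, every finite $n$-player game with losses in $[0,1]$ in which player $i$ has $d_i\ge1$ actions, every integer $T\ge1$, and every step size $0<\eta\le c_0/\sqrt n$, if all players use Optimistic Hedge with the common constant step size $\eta$ (under exact expected loss-vector feedback), then for every player $i$, $$\mathrm{Reg}_i(T)\le\frac{\log d_i}{\eta}+C+C\,\eta\, T\exp\!\left(-\frac{c_1}{\sqrt n\,\eta}\right).$$
   Context: Game. There are $n$ players; player $i\in[n]$ has action set $A_i=[d_i]=\{1,\dots,d_i\}$, $A=\prod_j A_j$, $A_{-i}=\prod_{j\ne i}A_j$, and loss function $\ell_i:A\to[0,1]$. $\Delta_d=\{x\in\mathbb R_{\ge0}^d:\sum_a x_a=1\}$. For mixed strategies $x_j\in\Delta_{d_j}$, the expected loss vector is $\ell_i(x_{-i})\in[0,1]^{d_i}$ with $[\ell_i(x_{-i})]_{a_i}=\sum_{a_{-i}\in A_{-i}}\ell_i(a_i,a_{-i})\prod_{j\ne i}x_{j,a_j}$. Optimistic Hedge self-play with step size $\eta>0$. For every player $i$: $x_i^1$ is uniform on $A_i$, $\ell_i^0=0\in\mathbb R^{d_i}$, and for every $t\ge1$, $\ell_i^t=\ell_i(x_{-i}^t)$ and $$x_{i,a}^{t+1}=\frac{x_{i,a}^t\exp\{-\eta(2\ell_{i,a}^t-\ell_{i,a}^{t-1})\}}{\sum_{b\in A_i}x_{i,b}^t\exp\{-\eta(2\ell_{i,b}^t-\ell_{i,b}^{t-1})\}},\qquad a\in A_i.$$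 External regret: $\mathrm{Reg}_i(T)=\sum_{t=1}^T\langle x_i^t,\ell_i^t\rangle-\min_{a\in A_i}\sum_{t=1}^T\ell_{i,a}^t$. "Universal constant" means an absolute constant, independent of $n$, the $d_j$, the losses, the player, $T$ and $\eta$. *)

theory Defs
  imports Complex_Main "HOL-Library.FuncSet"
begin

text \<open>
  A mixed profile is a function \<open>x\<close> with \<open>x j a\<close> the probability that player \<open>j\<close> gives to
  action \<open>a\<close>; only its values for \<open>j \<in> {1..n}\<close> and \<open>a \<in> {1..d j}\<close> matter.
\<close>

definition actions :: "(nat \<Rightarrow> nat) \<Rightarrow> nat \<Rightarrow> nat set" where
  "actions d i = {1..d i}"

definition profiles :: "nat \<Rightarrow> (nat \<Rightarrow> nat) \<Rightarrow> (nat \<Rightarrow> nat) set" where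
  "profiles n d = (\<Pi>\<^sub>E j\<in>{1..n}. actions d j)"

definition opp_profiles :: "nat \<Rightarrow> (nat \<Rightarrow> nat) \<Rightarrow> nat \<Rightarrow> (nat \<Rightarrow> nat) set" where
  "opp_profiles n d i = (\<Pi>\<^sub>E j\<in>{1..n} - {i}. actions d j)"

definition finite_game :: "nat \<Rightarrow> (nat \<Rightarrow> nat) \<Rightarrow> (nat \<Rightarrow> (nat \<Rightarrow> nat) \<Rightarrow> real) \<Rightarrow> bool" where
  "finite_game n d loss \<longleftrightarrow>
     (\<forall>i\<in>{1..n}. 1 \<le> d i) \<and>
     (\<forall>i\<in>{1..n}. \<forall>p\<in>profiles n d. 0 \<le> loss i p \<and> loss i p \<le> 1)"

text \<open>For \<open>q \<in> A\<^bsub>-i\<^esub>\<close>, the profile \<open>(a, q)\<close> is the update \<open>q(i := a)\<close>.\<close>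

definition expected_loss ::
  "nat \<Rightarrow> (nat \<Rightarrow> nat) \<Rightarrow> (nat \<Rightarrow> (nat \<Rightarrow> nat) \<Rightarrow> real) \<Rightarrow> (nat \<Rightarrow> nat \<Rightarrow> real) \<Rightarrow> nat \<Rightarrow> nat \<Rightarrow> real"
where
  "expected_loss n d loss x i a =
     (\<Sum>q\<in>opp_profiles n d i. loss i (q(i := a)) * (\<Prod>j\<in>{1..n} - {i}. x j (q j)))"

text \<open>
  From here on \<open>x t\<close> is the mixed profile of round \<open>t \<ge> 1\<close>; the value \<open>x 0\<close> is never used, and
  the loss vector of round \<open>0\<close> is zero by convention.
\<close>

definition loss_vec ::
  "nat \<Rightarrow> (nat \<Rightarrow> nat) \<Rightarrow> (nat \<Rightarrow> (nat \<Rightarrow> nat) \<Rightarrow> real) \<Rightarrow> (nat \<Rightarrow> nat \<Rightarrow> nat \<Rightarrow> real) \<Rightarrow>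
   nat \<Rightarrow> nat \<Rightarrow> nat \<Rightarrow> real"
where
  "loss_vec n d loss x t i a = (if t = 0 then 0 else expected_loss n d loss (x t) i a)"

definition oh_weight ::
  "nat \<Rightarrow> (nat \<Rightarrow> nat) \<Rightarrow> (nat \<Rightarrow> (nat \<Rightarrow> nat) \<Rightarrow> real) \<Rightarrow> real \<Rightarrow> (nat \<Rightarrow> nat \<Rightarrow> nat \<Rightarrow> real) \<Rightarrow>
   nat \<Rightarrow> nat \<Rightarrow> nat \<Rightarrow> real"
where
  "oh_weight n d loss \<eta> x t i a =
     x t i a * exp (- \<eta> * (2 * loss_vec n d loss x t i a - loss_vec n d loss x (t - 1) i a))"

definition optimistic_hedge ::
  "nat \<Rightarrow> (nat \<Rightarrow> nat) \<Rightarrow> (nat \<Rightarrow> (nat \<Rightarrow> nat) \<Rightarrow> real) \<Rightarrow> real \<Rightarrow> (nat \<Rightarrow> nat \<Rightarrow> nat \<Rightarrow> real) \<Rightarrow> bool"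
where
  "optimistic_hedge n d loss \<eta> x \<longleftrightarrow>
     (\<forall>i\<in>{1..n}. \<forall>a\<in>actions d i. x 1 i a = 1 / real (d i)) \<and>
     (\<forall>t\<ge>1. \<forall>i\<in>{1..n}. \<forall>a\<in>actions d i.
        x (t + 1) i a =
          oh_weight n d loss \<eta> x t i a / (\<Sum>b\<in>actions d i. oh_weight n d loss \<eta> x t i b))"

definition regret ::
  "nat \<Rightarrow> (nat \<Rightarrow> nat) \<Rightarrow> (nat \<Rightarrow> (nat \<Rightarrow> nat) \<Rightarrow> real) \<Rightarrow> (nat \<Rightarrow> nat \<Rightarrow> nat \<Rightarrow> real) \<Rightarrow>
   nat \<Rightarrow> nat \<Rightarrow> real"
where
  "regret n d loss x i T =
     (\<Sum>t=1..T. \<Sum>a\<in>actions d i. x t i a * loss_vec n d loss x t i a)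
     - Min ((\<lambda>a. \<Sum>t=1..T. loss_vec n d loss x t i a) ` actions d i)"

text \<open>The Optimistic Hedge recursion always has a solution.\<close>

lemma optimistic_hedge_exists: "\<exists>x. optimistic_hedge n d loss \<eta> x"
proof -
  define W where "W y l i a = y i a * exp (- \<eta> * (2 * expected_loss n d loss y i a - l i a))"
    for y l :: "nat \<Rightarrow> nat \<Rightarrow> real" and i a
  define step where "step s =
      (\<lambda>i a. W (fst s) (snd s) i a / (\<Sum>b\<in>actions d i. W (fst s) (snd s) i b),
       expected_loss n d loss (fst s))" for s :: "(nat \<Rightarrow> nat \<Rightarrow> real) \<times> (nat \<Rightarrow> nat \<Rightarrow> real)"
  define S where "S k = (step ^^ k) (\<lambda>i a. 1 / real (d i), \<lambda>i a. 0)" for k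
  define x where "x t = fst (S (t - 1))" for t
  have S_Suc: "S (Suc k) = step (S k)" for k
    by (simp add: S_def)
  have prev: "snd (S k) = loss_vec n d loss x k" for k
    by (cases k) (auto simp: S_def step_def x_def loss_vec_def fun_eq_iff)
  have weight: "W (fst (S k)) (snd (S k)) i a = oh_weight n d loss \<eta> x (Suc k) i a" for k i a
    unfolding prev by (simp add: W_def oh_weight_def loss_vec_def x_def)
  have "x 1 i a = 1 / real (d i)" for i a
    by (simp add: x_def S_def)
  moreover have "x (t + 1) i a =
      oh_weight n d loss \<eta> x t i a / (\<Sum>b\<in>actions d i. oh_weight n d loss \<eta> x t i b)"
    if "t \<ge> 1" for t i a
  proof -
    obtain k where t: "t = Suc k"
      using \<open>t \<ge> 1\<close> by (cases t) auto
    have "x (t + 1) = fst (step (S k))"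
      by (simp add: x_def t S_Suc)
    then show ?thesis
      by (simp add: step_def weight t)
  qed
  ultimately show ?thesis
    unfolding optimistic_hedge_def by blast
qed

end

theory Submission
  imports Defs "HOL-Analysis.L2_Norm"
begin

text \<open>
  Expanding the log-partition function bounds the regret by \<open>log d / \<eta>\<close> plus \<open>\<eta>\<close> times the sum over \<open>t\<close> of
  \<open>Var(\<ell>\<^sup>t - \<ell>\<^sup>t\<^sup>-\<^sup>1) - Var(\<ell>\<^sup>t\<^sup>-\<^sup>1) / 4\<close>, variances being taken under \<open>x\<^sup>t\<close>. It remains to dominate the energy \<open>a\<^sub>1\<close> of
  the first differences by a quarter of the energy \<open>a\<^sub>0\<close> of the losses, where \<open>a\<^sub>k\<close> is the summed
  variance of the \<open>k\<close>-th differences.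

  The losses are smooth to high order: the \<open>k\<close>-th differences are at most \<open>8\<^sup>-\<^sup>k\<close> for \<open>k \<le> h\<close>, with \<open>h\<close> of
  order \<open>1 / (sqrt n * \<eta>)\<close>. This is an induction on \<open>k\<close> with discrete Cauchy majorants: the logits of the next rounds
  are \<open>\<eta>\<close> times sums of losses, the softmax preserves the majorants, and orthogonality of the
  centred likelihood ratios of different players yields \<open>sqrt n\<close> in place of \<open>n\<close>.

  The weights \<open>x\<^sup>t\<close> change by a factor \<open>1 + O(\<eta>)\<close> per round, so summation by parts gives
  \<open>a\<^sub>k\<^sup>2 \<le> (1 + O(\<eta>)) a\<^sub>k\<^sub>-\<^sub>1 a\<^sub>k\<^sub>+\<^sub>1\<close> up to lower-order terms. Hence if \<open>a\<^sub>1 > a\<^sub>0 / 4\<close> then the ratios \<open>a\<^sub>k\<^sub>+\<^sub>1 / a\<^sub>k\<close>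
  stay above \<open>1 / 16\<close> up to \<open>k = h\<close>, while \<open>a\<^sub>h \<le> 4 T / 64\<^sup>h\<close>; then \<open>a\<^sub>0\<close> itself is exponentially small
  in \<open>h\<close> relative to \<open>T\<close>.
\<close>

subsection \<open>Forward differences\<close>

primrec fd :: "nat \<Rightarrow> (nat \<Rightarrow> real) \<Rightarrow> nat \<Rightarrow> real" where
  "fd 0 f s = f s"
| "fd (Suc l) f s = fd l f (Suc s) - fd l f s"

lemma fd_shift: "fd l (\<lambda>s. f (m + s)) s = fd l f (m + s)"
  by (induction l arbitrary: s) auto

lemma fd_Suc': "fd (Suc l) f s = fd l (\<lambda>u. f (Suc u) - f u) s"
  by (induction l arbitrary: s) auto

lemma fd_add: "fd l (\<lambda>s. f s + g s) s = fd l f s + fd l g s"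
  by (induction l arbitrary: s) auto

lemma fd_diff: "fd l (\<lambda>s. f s - g s) s = fd l f s - fd l g s"
  by (induction l arbitrary: s) auto

lemma fd_cmult: "fd l (\<lambda>s. c * f s) s = c * fd l f s"
  by (induction l arbitrary: s) (auto simp: algebra_simps)

lemma fd_cmult_right: "fd l (\<lambda>s. f s * c) s = fd l f s * c"
  by (induction l arbitrary: s) (auto simp: algebra_simps)

lemma fd_sum: "fd l (\<lambda>s. \<Sum>i\<in>I. f i s) s = (\<Sum>i\<in>I. fd l (f i) s)"
  by (induction l arbitrary: s) (auto simp: sum_subtractf)

lemma fd_const: "l > 0 \<Longrightarrow> fd l (\<lambda>s. c) s = 0"
proof (induction l arbitrary: s)
  case (Suc l)
  then show ?case by (cases l) auto
qed auto

lemma fd_sums: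
  assumes "\<And>u. u \<le> k \<Longrightarrow> (\<lambda>p. F p u) sums G u" "l + s \<le> k"
  shows "(\<lambda>p. fd l (F p) s) sums fd l G s"
  using assms(2)
proof (induction l arbitrary: s)
  case (Suc l)
  then show ?case using sums_diff[OF Suc.IH[of "Suc s"] Suc.IH[of s]] by auto
qed (use assms(1) in auto)

text \<open>Discrete Leibniz rule. One more difference splits as the difference of the first factor
  times the second factor one step later, plus the first factor times the difference of the second;
  Pascal's rule collects the coefficients.\<close>

lemma fd_mult:
  "fd l (\<lambda>s. f s * g s) s = (\<Sum>i\<le>l. real (l choose i) * (fd i f s * fd (l - i) g (s + i)))"
proof (induction l arbitrary: s)
  case (Suc l)
  let ?X = "\<lambda>i. fd (Suc i) f s * fd (l - i) g (Suc s + i)"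
  let ?Y = "\<lambda>i. fd i f s * fd (Suc l - i) g (s + i)"
  have step: "fd i f (Suc s) * fd (l - i) g (Suc s + i) - fd i f s * fd (l - i) g (s + i) = ?X i + ?Y i"
    if "i \<le> l" for i
    using that by (simp add: Suc_diff_le algebra_simps)
  have "fd (Suc l) (\<lambda>s. f s * g s) s
      = (\<Sum>i\<le>l. real (l choose i) * (?X i + ?Y i))"
    unfolding fd.simps Suc.IH sum_subtractf[symmetric] right_diff_distrib[symmetric]
    by (intro sum.cong refl) (use step in auto)
  also have "\<dots> = (\<Sum>i\<le>l. real (l choose i) * ?X i) + (\<Sum>i\<le>l. real (l choose i) * ?Y i)"
    by (simp only: distrib_left sum.distrib)
  also have "(\<Sum>i\<le>l. real (l choose i) * ?Y i) = (\<Sum>i\<le>Suc l. real (l choose i) * ?Y i)"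
    by simp
  also have "\<dots> = ?Y 0 + (\<Sum>i\<le>l. real (l choose Suc i) * ?Y (Suc i))"
    by (subst sum.atMost_Suc_shift) simp
  also have "(\<Sum>i\<le>l. real (l choose i) * ?X i) + \<dots>
      = ?Y 0 + (\<Sum>i\<le>l. real (Suc l choose Suc i) * ?Y (Suc i))"
    by (simp add: sum.distrib distrib_right del: fd.simps)
  also have "\<dots> = (\<Sum>i\<le>Suc l. real (Suc l choose i) * ?Y i)"
    by (simp add: sum.atMost_Suc_shift del: sum.atMost_Suc fd.simps binomial_Suc_Suc)
  finally show ?case .
qed simp

subsection \<open>Majorants\<close>

text \<open>
  The factor \<open>1 / (l + 1)\<^sup>2\<close> makes the weights submultiplicative under binomial convolution
  (\<open>bw_convolution\<close>), so that products of majorized sequences are majorized with no loss in \<open>r\<close>.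
\<close>

definition bw :: "real \<Rightarrow> nat \<Rightarrow> real" where
  "bw r l = fact l / (8 * (real l + 1)\<^sup>2 * r ^ l)"

text \<open>The correction \<open>- 1 / (real l + 1)\<close> makes the induction close: each new
  inverse square is at most a telescoping difference of reciprocals.\<close>

lemma sum_inverse_squares_le: "(\<Sum>i\<le>l. 1 / (real i + 1)\<^sup>2) \<le> 2 - 1 / (real l + 1)"
proof (induction l)
  case (Suc l)
  have "1 / (real l + 2)\<^sup>2 \<le> 1 / (real l + 1) - 1 / (real l + 2)"
  proof -
    have "1 / (real l + 2)\<^sup>2 \<le> 1 / ((real l + 1) * (real l + 2))"
      unfolding power2_eq_square by (intro divide_left_mono mult_right_mono) auto
    also have "\<dots> = 1 / (real l + 1) - 1 / (real l + 2)"
      by (simp add: divide_simps)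
    finally show ?thesis .
  qed
  then show ?case using Suc by (simp add: algebra_simps)
qed simp

text \<open>As \<open>(a + b)\<^sup>2\<close> is at most twice the sum of squares, each term splits
  into two inverse squares with the common factor \<open>2 / (real l + 1)\<^sup>2\<close>, and each
  of the two resulting sums is at most 2. The final 8 is what the 8 in the denominator of
  \<open>bw\<close> cancels.\<close>

lemma inverse_square_convolution:
  "(\<Sum>i\<le>l. 1 / ((real i + 1)\<^sup>2 * (real (l - i) + 1)\<^sup>2)) \<le> 8 / (real l + 1)\<^sup>2"
proof -
  have ineq: "1 / (a\<^sup>2 * b\<^sup>2) \<le> 2 / (a + b - 1)\<^sup>2 * (1 / a\<^sup>2 + 1 / b\<^sup>2)" if "a \<ge> 1" "b \<ge> 1" for a b :: real
  proof -
    have "(a + b - 1)\<^sup>2 \<le> (a + b)\<^sup>2"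
      using that by (intro power_mono) auto
    also have "\<dots> \<le> 2 * (a\<^sup>2 + b\<^sup>2)"
      using sum_squares_bound[of a b] by (simp add: power2_eq_square algebra_simps)
    finally have "(a + b - 1)\<^sup>2 / ((a + b - 1)\<^sup>2 * (a\<^sup>2 * b\<^sup>2)) \<le> 2 * (a\<^sup>2 + b\<^sup>2) / ((a + b - 1)\<^sup>2 * (a\<^sup>2 * b\<^sup>2))"
      by (rule divide_right_mono) auto
    with that show ?thesis by (simp add: divide_simps split: if_splits)
  qed
  have "(\<Sum>i\<le>l. 1 / ((real i + 1)\<^sup>2 * (real (l - i) + 1)\<^sup>2))
     \<le> (\<Sum>i\<le>l. 2 / (real l + 1)\<^sup>2 * (1 / (real i + 1)\<^sup>2 + 1 / (real (l - i) + 1)\<^sup>2))"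
  proof (rule sum_mono)
    fix i assume "i \<in> {..l}"
    then have eq: "(real i + 1) + (real (l - i) + 1) - 1 = real l + 1" by auto
    then show "1 / ((real i + 1)\<^sup>2 * (real (l - i) + 1)\<^sup>2) \<le>
      2 / (real l + 1)\<^sup>2 * (1 / (real i + 1)\<^sup>2 + 1 / (real (l - i) + 1)\<^sup>2)"
      using ineq[of "real i + 1" "real (l - i) + 1", unfolded eq] by simp
  qed
  also have "\<dots> = 2 / (real l + 1)\<^sup>2 * ((\<Sum>i\<le>l. 1 / (real i + 1)\<^sup>2) + (\<Sum>i\<le>l. 1 / (real (l - i) + 1)\<^sup>2))"
    by (simp only: sum_distrib_left[symmetric] sum.distrib)
  also have "(\<Sum>i\<le>l. 1 / (real (l - i) + 1)\<^sup>2) = (\<Sum>i\<le>l. 1 / (real i + 1)\<^sup>2)"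
    using sum.nat_diff_reindex[of "\<lambda>i. 1 / (real i + 1)\<^sup>2" "Suc l"] by (simp add: lessThan_Suc_atMost)
  also have "2 / (real l + 1)\<^sup>2 * ((\<Sum>i\<le>l. 1 / (real i + 1)\<^sup>2) + (\<Sum>i\<le>l. 1 / (real i + 1)\<^sup>2))
      \<le> 2 / (real l + 1)\<^sup>2 * (2 + 2)"
    by (intro mult_left_mono add_mono order_trans[OF sum_inverse_squares_le]) auto
  finally show ?thesis by simp
qed

lemma bw_nonneg: "r > 0 \<Longrightarrow> 0 \<le> bw r l"
  by (simp add: bw_def)

lemma bw_convolution:
  assumes "r > 0"
  shows "(\<Sum>i\<le>l. real (l choose i) * (bw r i * bw r (l - i))) \<le> bw r l"
proof -
  have "(\<Sum>i\<le>l. real (l choose i) * (bw r i * bw r (l - i)))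
     = (\<Sum>i\<le>l. fact l / (64 * r ^ l) * (1 / ((real i + 1)\<^sup>2 * (real (l - i) + 1)\<^sup>2)))"
  proof (rule sum.cong[OF refl])
    fix i assume "i \<in> {..l}"
    then have i: "i \<le> l" by simp
    have "real (l choose i) * fact i * fact (l - i) = fact l"
      using binomial_fact[OF i, where 'a=real] by simp
    moreover have "r ^ l = r ^ i * r ^ (l - i)"
      using i by (simp flip: power_add)
    ultimately show "real (l choose i) * (bw r i * bw r (l - i))
        = fact l / (64 * r ^ l) * (1 / ((real i + 1)\<^sup>2 * (real (l - i) + 1)\<^sup>2))"
      by (simp add: bw_def) (simp add: mult_ac)
  qed
  also have "\<dots> = fact l / (64 * r ^ l) * (\<Sum>i\<le>l. 1 / ((real i + 1)\<^sup>2 * (real (l - i) + 1)\<^sup>2))"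
    by (simp only: sum_distrib_left)
  also have "\<dots> \<le> fact l / (64 * r ^ l) * (8 / (real l + 1)\<^sup>2)"
    using assms by (intro mult_left_mono inverse_square_convolution) auto
  also have "\<dots> = bw r l"
    by (simp add: bw_def)
  finally show ?thesis .
qed

text \<open>
  The discrete Leibniz rule shifts the second factor; \<open>maj\<close> bounds the differences at all points of
  the window \<open>{0..k}\<close> at once, which makes it a Banach algebra norm bound.
\<close>

definition maj :: "real \<Rightarrow> nat \<Rightarrow> real \<Rightarrow> (nat \<Rightarrow> real) \<Rightarrow> bool" where
  "maj r k c f \<longleftrightarrow> (\<forall>l s. l + s \<le> k \<longrightarrow> \<bar>fd l f s\<bar> \<le> c * bw r l)"

lemma majD: "maj r k c f \<Longrightarrow> l + s \<le> k \<Longrightarrow> \<bar>fd l f s\<bar> \<le> c * bw r l"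
  by (auto simp: maj_def)

lemma majI: "(\<And>l s. l + s \<le> k \<Longrightarrow> \<bar>fd l f s\<bar> \<le> c * bw r l) \<Longrightarrow> maj r k c f"
  by (auto simp: maj_def)

lemma maj_mono:
  assumes "r > 0" "maj r k c f" "c \<le> c'"
  shows "maj r k c' f"
proof (rule majI)
  fix l s assume "l + s \<le> k"
  then have "\<bar>fd l f s\<bar> \<le> c * bw r l" by (rule majD[OF assms(2)])
  also have "\<dots> \<le> c' * bw r l" using assms bw_nonneg by (intro mult_right_mono) auto
  finally show "\<bar>fd l f s\<bar> \<le> c' * bw r l" .
qed

lemma maj_nonneg:
  assumes "r > 0" "maj r k c f"
  shows "c \<ge> 0"
proof -
  have "0 \<le> c * bw r 0" using majD[OF assms(2), of 0 0] by (intro order_trans[OF abs_ge_zero]) auto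
  then show ?thesis by (simp add: bw_def)
qed

lemma maj_value:
  assumes "r > 0" "maj r k c f" "s \<le> k"
  shows "\<bar>f s\<bar> \<le> c / 8"
  using majD[OF assms(2), of 0 s] assms(3) by (simp add: bw_def)

lemma maj_add:
  assumes "maj r k c f" "maj r k c' g"
  shows "maj r k (c + c') (\<lambda>s. f s + g s)"
proof (rule majI)
  fix l s assume "l + s \<le> k"
  then show "\<bar>fd l (\<lambda>s. f s + g s) s\<bar> \<le> (c + c') * bw r l"
    using majD[OF assms(1), of l s] majD[OF assms(2), of l s] by (simp add: fd_add distrib_right)
qed

lemma maj_uminus: "maj r k c f \<Longrightarrow> maj r k c (\<lambda>s. - f s)"
  using fd_cmult[of _ "-1" f] by (simp add: maj_def)

lemma maj_convex_sum:
  assumes "r > 0" "\<And>a. a \<in> A \<Longrightarrow> maj r k c (f a)" "\<And>a. a \<in> A \<Longrightarrow> p a \<ge> 0" "(\<Sum>a\<in>A. p a) = 1"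
  shows "maj r k c (\<lambda>s. \<Sum>a\<in>A. p a * f a s)"
proof (rule majI)
  fix l s assume ls: "l + s \<le> k"
  have "\<bar>fd l (\<lambda>s. \<Sum>a\<in>A. p a * f a s) s\<bar> \<le> (\<Sum>a\<in>A. \<bar>p a * fd l (f a) s\<bar>)"
    by (simp add: fd_sum fd_cmult sum_abs)
  also have "\<dots> \<le> (\<Sum>a\<in>A. p a * (c * bw r l))"
    using majD[OF assms(2) ls] assms(3) by (intro sum_mono) (auto simp: abs_mult intro!: mult_left_mono)
  also have "\<dots> = c * bw r l"
    using assms(4) by (simp flip: sum_distrib_right)
  finally show "\<bar>fd l (\<lambda>s. \<Sum>a\<in>A. p a * f a s) s\<bar> \<le> c * bw r l" .
qed

lemma maj_mult:
  assumes "r > 0" "maj r k c f" "maj r k c' g"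
  shows "maj r k (c * c') (\<lambda>s. f s * g s)"
proof (rule majI)
  fix l s assume ls: "l + s \<le> k"
  have c: "c \<ge> 0" "c' \<ge> 0" using assms maj_nonneg by auto
  have "\<bar>fd l (\<lambda>s. f s * g s) s\<bar> \<le> (\<Sum>i\<le>l. \<bar>real (l choose i) * (fd i f s * fd (l - i) g (s + i))\<bar>)"
    unfolding fd_mult by (rule sum_abs)
  also have "\<dots> \<le> (\<Sum>i\<le>l. real (l choose i) * ((c * bw r i) * (c' * bw r (l - i))))"
    unfolding abs_mult abs_of_nat using ls c bw_nonneg[OF assms(1)]
    by (intro sum_mono mult_left_mono mult_mono majD[OF assms(2)] majD[OF assms(3)] mult_nonneg_nonneg) auto
  also have "\<dots> = c * c' * (\<Sum>i\<le>l. real (l choose i) * (bw r i * bw r (l - i)))"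
    by (simp add: sum_distrib_left mult_ac)
  also have "\<dots> \<le> c * c' * bw r l"
    using c by (intro mult_left_mono bw_convolution assms) auto
  finally show "\<bar>fd l (\<lambda>s. f s * g s) s\<bar> \<le> c * c' * bw r l" .
qed

text \<open>Only positive powers are controlled: as \<open>bw r 0 = 1 / 8\<close>, the constant 1
  has norm 8. Hence the functions below are expanded around 1 with the constant term
  removed.\<close>

lemma maj_power:
  assumes "r > 0" "maj r k c f"
  shows "maj r k (c ^ Suc p) (\<lambda>s. f s ^ Suc p)"
proof (induction p)
  case (Suc p)
  then show ?case using maj_mult[OF assms(1,2) Suc] by (simp only: power_Suc)
qed (use assms in simp)

text \<open>A difference of given order at a given point is a finite combination of values, so
  pointwise convergence on the window is enough to pass the bounds to the limit.\<close>

lemma maj_sums: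
  assumes "r > 0" "\<And>p. maj r k (c p) (F p)" "c sums C" "\<And>s. s \<le> k \<Longrightarrow> (\<lambda>p. F p s) sums G s"
  shows "maj r k C G"
proof (rule majI)
  fix l s assume ls: "l + s \<le> k"
  have 1: "(\<lambda>p. fd l (F p) s) sums fd l G s"
    using fd_sums[OF assms(4) ls] by simp
  have 2: "(\<lambda>p. c p * bw r l) sums (C * bw r l)"
    by (intro sums_mult2 assms)
  have 3: "\<bar>fd l (F p) s\<bar> \<le> c p * bw r l" for p
    by (rule majD[OF assms(2) ls])
  have "fd l G s \<le> C * bw r l"
    by (rule sums_le[OF _ 1 2]) (use 3 in \<open>simp add: abs_le_iff\<close>)
  moreover have "- fd l G s \<le> C * bw r l"
    by (rule sums_le[OF _ sums_minus[OF 1] 2]) (use 3 in \<open>simp add: abs_le_iff\<close>)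
  ultimately show "\<bar>fd l G s\<bar> \<le> C * bw r l" by simp
qed

section \<open>Exponential, reciprocal and softmax of majorized sequences\<close>

lemma exp_minus_one_sums: "(\<lambda>p. y ^ Suc p / fact (Suc p)) sums (exp y - 1)" for y :: real
  using exp_converges[of y] sums_Suc_iff[of "\<lambda>p. y ^ p / fact p" "exp y - 1"]
  by (simp add: divide_inverse mult.commute)

lemma maj_exp:
  assumes "r > 0" "maj r k c f"
  shows "maj r k (exp c - 1) (\<lambda>s. exp (f s) - 1)"
proof (rule maj_sums[OF assms(1) _ exp_minus_one_sums exp_minus_one_sums])
  fix p
  have "fd l (\<lambda>s. f s ^ Suc p / fact (Suc p)) s = fd l (\<lambda>s. f s ^ Suc p) s / fact (Suc p)" for l s
    using fd_cmult_right[of l "\<lambda>s. f s ^ Suc p" "1 / fact (Suc p)" s] by simp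
  then show "maj r k (c ^ Suc p / fact (Suc p)) (\<lambda>s. f s ^ Suc p / fact (Suc p))"
    using maj_power[OF assms, of p] unfolding maj_def
    by (auto simp: abs_divide divide_right_mono simp del: power_Suc fact_Suc)
qed

text \<open>Neumann series. The condition \<open>c < 1\<close> sums the series of bounds and,
  through \<open>maj_value\<close>, also the series of values.\<close>

lemma maj_reciprocal:
  assumes "r > 0" "maj r k c u" "c < 1"
  shows "maj r k (c / (1 - c)) (\<lambda>s. 1 / (1 + u s) - 1)"
proof (rule maj_sums[OF assms(1)])
  have geo: "(\<lambda>p. y ^ Suc p) sums (y / (1 - y))" if "\<bar>y\<bar> < 1" for y :: real
    using sums_mult[OF geometric_sums[of y], of y] that by simp
  have "c \<ge> 0" using assms maj_nonneg by auto
  then show "(\<lambda>p. c ^ Suc p) sums (c / (1 - c))" using geo[of c] assms by simp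
  show "maj r k (c ^ Suc p) (\<lambda>s. (- u s) ^ Suc p)" for p
    by (rule maj_power[OF assms(1) maj_uminus[OF assms(2)]])
  fix s assume "s \<le> k"
  then have "\<bar>u s\<bar> \<le> c / 8" using maj_value assms by auto
  then have "\<bar>- u s\<bar> < 1" using \<open>c < 1\<close> by linarith
  then have "(\<lambda>p. (- u s) ^ Suc p) sums (- u s / (1 - - u s))" by (rule geo)
  moreover have "- u s / (1 - - u s) = 1 / (1 + u s) - 1"
    using \<open>\<bar>- u s\<bar> < 1\<close> by (simp add: field_simps)
  ultimately show "(\<lambda>p. (- u s) ^ Suc p) sums (1 / (1 + u s) - 1)" by simp
qed

text \<open>The normaliser is 1 plus a convex combination of the centred exponentials, so its
  majorant does not depend on the number of actions. The three expansions cost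
  \<open>2 * \<epsilon>\<close> for the exponential, \<open>3 * \<epsilon>\<close> for the
  reciprocal and the product of the two.\<close>

lemma maj_softmax_ratio:
  assumes r: "r > 0" and \<epsilon>: "\<epsilon> \<le> 1 / 10"
    and \<zeta>: "\<And>a. a \<in> A \<Longrightarrow> maj r k \<epsilon> (\<zeta> a)"
    and p: "\<And>a. a \<in> A \<Longrightarrow> p a \<ge> 0" "(\<Sum>a\<in>A. p a) = 1" and a: "a \<in> A"
  shows "maj r k (10 * \<epsilon>) (\<lambda>s. exp (\<zeta> a s) / (\<Sum>b\<in>A. p b * exp (\<zeta> b s)) - 1)"
proof -
  have \<epsilon>0: "\<epsilon> \<ge> 0" using maj_nonneg[OF r \<zeta>[OF a]] .
  have "exp \<epsilon> \<le> 1 + \<epsilon> + \<epsilon>\<^sup>2" using exp_bound[of \<epsilon>] \<epsilon> \<epsilon>0 by simp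
  also have "\<epsilon>\<^sup>2 \<le> \<epsilon>" using \<epsilon> \<epsilon>0 by (simp add: power2_eq_square mult_left_le)
  finally have e: "maj r k (2 * \<epsilon>) (\<lambda>s. exp (\<zeta> b s) - 1)" if "b \<in> A" for b
    by (intro maj_mono[OF r maj_exp[OF r \<zeta>[OF that]]]) auto
  define u where "u s = (\<Sum>b\<in>A. p b * (exp (\<zeta> b s) - 1))" for s
  have u: "maj r k (2 * \<epsilon>) u"
    unfolding u_def by (rule maj_convex_sum[OF r e p])
  have "2 * \<epsilon> / (1 - 2 * \<epsilon>) \<le> 3 * \<epsilon>"
    using \<epsilon> \<epsilon>0 by (simp add: field_simps)
      (use mult_left_mono[OF \<epsilon> \<epsilon>0] in linarith)
  then have g: "maj r k (3 * \<epsilon>) (\<lambda>s. 1 / (1 + u s) - 1)"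
    using \<epsilon> by (intro maj_mono[OF r maj_reciprocal[OF r u]]) auto
  have "maj r k (2 * \<epsilon> + (3 * \<epsilon> + 2 * \<epsilon> * (3 * \<epsilon>)))
     (\<lambda>s. (exp (\<zeta> a s) - 1) + ((1 / (1 + u s) - 1) + (exp (\<zeta> a s) - 1) * (1 / (1 + u s) - 1)))"
    by (intro maj_add maj_mult r g e a)
  moreover have "2 * \<epsilon> + (3 * \<epsilon> + 2 * \<epsilon> * (3 * \<epsilon>)) \<le> 10 * \<epsilon>"
    using mult_left_mono[OF \<epsilon> \<epsilon>0] \<epsilon>0 by simp
  moreover have "1 + u s = (\<Sum>b\<in>A. p b * exp (\<zeta> b s))" for s
    using p(2) by (simp add: u_def right_diff_distrib sum_subtractf)
  moreover have "(e - 1) + ((1 / v - 1) + (e - 1) * (1 / v - 1)) = e / v - 1" for e v :: real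
    by (simp add: algebra_simps diff_divide_distrib)
  ultimately show ?thesis using maj_mono[OF r] by simp
qed

subsection \<open>Majorants in two variables\<close>

text \<open>Two variables make the square of a difference of \<open>f\<close> linear in the kernel
  \<open>f s * f u\<close> (\<open>fd2_tensor\<close>), so squares can be averaged over profiles
  before anything is estimated.\<close>

definition fd2 :: "nat \<Rightarrow> nat \<Rightarrow> (nat \<Rightarrow> nat \<Rightarrow> real) \<Rightarrow> nat \<Rightarrow> nat \<Rightarrow> real" where
  "fd2 l m K s u = fd l (\<lambda>s. fd m (K s) u) s"

lemma fd2_add: "fd2 l m (\<lambda>s u. K s u + K' s u) s u = fd2 l m K s u + fd2 l m K' s u"
  by (simp add: fd2_def fd_add)

lemma fd2_sum: "fd2 l m (\<lambda>s u. \<Sum>i\<in>I. K i s u) s u = (\<Sum>i\<in>I. fd2 l m (K i) s u)"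
  by (simp add: fd2_def fd_sum)

lemma fd2_cmult: "fd2 l m (\<lambda>s u. c * K s u) s u = c * fd2 l m K s u"
  by (simp add: fd2_def fd_cmult)

lemma fd2_tensor: "fd2 l m (\<lambda>s u. f s * g u) s u = fd l f s * fd m g u"
  by (simp add: fd2_def fd_cmult fd_cmult_right)

lemma fd2_const: "l > 0 \<Longrightarrow> fd2 l m (\<lambda>s u. c) s u = 0"
  by (simp add: fd2_def fd_const)

lemma fd2_mult:
  "fd2 l m (\<lambda>s u. K s u * K' s u) s u =
    (\<Sum>j\<le>m. \<Sum>i\<le>l. real (m choose j) * (real (l choose i) * (fd2 i j K s u * fd2 (l - i) (m - j) K' (s + i) (u + j))))"
proof -
  have "fd2 l m (\<lambda>s u. K s u * K' s u) s u
      = (\<Sum>j\<le>m. real (m choose j) * fd l (\<lambda>s. fd j (K s) u * fd (m - j) (K' s) (u + j)) s)"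
    by (simp only: fd2_def fd_mult[of m] fd_sum fd_cmult)
  also have "\<dots> = (\<Sum>j\<le>m. \<Sum>i\<le>l. real (m choose j) * (real (l choose i)
      * (fd2 i j K s u * fd2 (l - i) (m - j) K' (s + i) (u + j))))"
    by (simp only: fd2_def fd_mult[of l] sum_distrib_left)
  finally show ?thesis .
qed

definition maj2 :: "real \<Rightarrow> nat \<Rightarrow> real \<Rightarrow> (nat \<Rightarrow> nat \<Rightarrow> real) \<Rightarrow> bool" where
  "maj2 r k c K \<longleftrightarrow>
    (\<forall>l s m u. l + s \<le> k \<longrightarrow> m + u \<le> k \<longrightarrow> \<bar>fd2 l m K s u\<bar> \<le> c * (bw r l * bw r m))"

lemma maj2D: "maj2 r k c K \<Longrightarrow> l + s \<le> k \<Longrightarrow> m + u \<le> k \<Longrightarrow> \<bar>fd2 l m K s u\<bar> \<le> c * (bw r l * bw r m)"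
  by (auto simp: maj2_def)

lemma maj2I:
  "(\<And>l s m u. l + s \<le> k \<Longrightarrow> m + u \<le> k \<Longrightarrow> \<bar>fd2 l m K s u\<bar> \<le> c * (bw r l * bw r m)) \<Longrightarrow> maj2 r k c K"
  by (auto simp: maj2_def)

lemma maj2_add:
  assumes "maj2 r k c K" "maj2 r k c' K'"
  shows "maj2 r k (c + c') (\<lambda>s u. K s u + K' s u)"
proof (rule maj2I)
  fix l s m u assume "l + s \<le> k" "m + u \<le> k"
  then show "\<bar>fd2 l m (\<lambda>s u. K s u + K' s u) s u\<bar> \<le> (c + c') * (bw r l * bw r m)"
    using maj2D[OF assms(1), of l s m u] maj2D[OF assms(2), of l s m u]
    by (simp add: fd2_add distrib_right)
qed

lemma maj2_mult:
  assumes "r > 0" "maj2 r k c K" "maj2 r k c' K'" "c \<ge> 0" "c' \<ge> 0"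
  shows "maj2 r k (c * c') (\<lambda>s u. K s u * K' s u)"
proof (rule maj2I)
  fix l s m u assume ls: "l + s \<le> k" and mu: "m + u \<le> k"
  note b = bw_nonneg[OF assms(1)]
  let ?S = "\<lambda>l. \<Sum>i\<le>l. real (l choose i) * (bw r i * bw r (l - i))"
  have "\<bar>fd2 l m (\<lambda>s u. K s u * K' s u) s u\<bar> \<le> (\<Sum>j\<le>m. \<Sum>i\<le>l. \<bar>real (m choose j) * (real (l choose i)
       * (fd2 i j K s u * fd2 (l - i) (m - j) K' (s + i) (u + j)))\<bar>)"
    unfolding fd2_mult by (intro order_trans[OF sum_abs] sum_mono sum_abs)
  also have "\<dots> \<le> (\<Sum>j\<le>m. \<Sum>i\<le>l. real (m choose j) * (real (l choose i)
       * ((c * (bw r i * bw r j)) * (c' * (bw r (l - i) * bw r (m - j))))))"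
    unfolding abs_mult abs_of_nat using ls mu assms(4,5) b
    by (intro sum_mono mult_left_mono mult_mono maj2D[OF assms(2)] maj2D[OF assms(3)] mult_nonneg_nonneg) auto
  also have "\<dots> = (\<Sum>j\<le>m. \<Sum>i\<le>l. c * c' * ((real (m choose j) * (bw r j * bw r (m - j)))
       * (real (l choose i) * (bw r i * bw r (l - i)))))"
    by (simp only: mult_ac)
  also have "\<dots> = c * c' * (?S m * ?S l)"
    unfolding sum_product by (simp only: sum_distrib_left)
  also have "\<dots> = c * c' * (?S l * ?S m)"
    by (simp only: mult.commute)
  also have "\<dots> \<le> c * c' * (bw r l * bw r m)"
    using assms b by (intro mult_left_mono mult_mono bw_convolution mult_nonneg_nonneg sum_nonneg) auto
  finally show "\<bar>fd2 l m (\<lambda>s u. K s u * K' s u) s u\<bar> \<le> c * c' * (bw r l * bw r m)" .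
qed

text \<open>The product is expanded around 1 one factor at a time. Excesses over 1 are tracked
  because the constant 1 itself has norm 64 here.\<close>

lemma maj2_prod:
  assumes "r > 0" "finite J" "c \<ge> 0" "\<And>j. j \<in> J \<Longrightarrow> maj2 r k c (\<lambda>s u. K j s u - 1)"
  shows "maj2 r k ((1 + c) ^ card J - 1) (\<lambda>s u. (\<Prod>j\<in>J. K j s u) - 1)"
  using assms(2,4)
proof (induction J)
  case empty
  then show ?case by (simp add: maj2_def fd2_def fd_cmult[of _ 0 "\<lambda>s. 0", simplified])
next
  case (insert j J)
  define C where "C = (1 + c) ^ card J - 1"
  have C: "C \<ge> 0" using assms(3) by (simp add: C_def)
  define P where "P s u = (\<Prod>j\<in>J. K j s u) - 1" for s u
  have P: "maj2 r k C P" using insert by (simp add: C_def P_def[abs_def])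
  have "maj2 r k (c + (C + c * C)) (\<lambda>s u. (K j s u - 1) + (P s u + (K j s u - 1) * P s u))"
    using C insert.prems by (intro maj2_add maj2_mult P assms(1,3)) auto
  moreover have "c + (C + c * C) = (1 + c) ^ card (insert j J) - 1"
    using insert by (simp add: C_def algebra_simps)
  moreover have "(K j s u - 1) + (P s u + (K j s u - 1) * P s u) = (\<Prod>j\<in>insert j J. K j s u) - 1" for s u
    using insert by (simp add: P_def algebra_simps)
  ultimately show ?case by simp
qed

lemma maj2_convex_tensor:
  assumes "r > 0" "\<And>a. a \<in> A \<Longrightarrow> maj r k c (f a)" "\<And>a. a \<in> A \<Longrightarrow> p a \<ge> 0" "(\<Sum>a\<in>A. p a) = 1"
  shows "maj2 r k (c\<^sup>2) (\<lambda>s u. \<Sum>a\<in>A. p a * (f a s * f a u))"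
proof (rule maj2I)
  fix l s m u assume ls: "l + s \<le> k" and mu: "m + u \<le> k"
  have "\<bar>fd2 l m (\<lambda>s u. \<Sum>a\<in>A. p a * (f a s * f a u)) s u\<bar> \<le> (\<Sum>a\<in>A. \<bar>p a * (fd l (f a) s * fd m (f a) u)\<bar>)"
    by (simp add: fd2_sum fd2_cmult fd2_tensor sum_abs)
  also have "\<dots> \<le> (\<Sum>a\<in>A. p a * ((c * bw r l) * (c * bw r m)))"
    unfolding abs_mult
    using assms(3) ls mu bw_nonneg[OF assms(1)] maj_nonneg[OF assms(1) assms(2)]
    by (intro sum_mono mult_mono majD[OF assms(2)] mult_nonneg_nonneg) auto
  also have "\<dots> = c\<^sup>2 * (bw r l * bw r m)"
    using assms(4) by (simp flip: sum_distrib_right add: power2_eq_square)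
  finally show "\<bar>fd2 l m (\<lambda>s u. \<Sum>a\<in>A. p a * (f a s * f a u)) s u\<bar> \<le> c\<^sup>2 * (bw r l * bw r m)" .
qed

subsection \<open>Energy of first differences\<close>

text \<open>Telescopes \<open>w t * (u t * fd 1 u t)\<close>, whose increment is expanded by
  applying the product rule twice.\<close>

lemma summation_by_parts:
  fixes w u :: "nat \<Rightarrow> real"
  assumes "m0 \<le> m1"
  shows "(\<Sum>t=m0..<m1. w t * (fd 1 u t)\<^sup>2) =
    w m1 * (u m1 * fd 1 u m1) - w m0 * (u m0 * fd 1 u m0)
    - (\<Sum>t=m0..<m1. (w (Suc t) - w t) * (u (Suc t) * fd 1 u (Suc t)))
    - (\<Sum>t=m0..<m1. w t * (u (Suc t) * fd 2 u t))"
  using assms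
proof (induction rule: dec_induct)
  case (step m)
  then show ?case
    by (simp add: numeral_2_eq_2) (simp add: power2_eq_square algebra_simps)
qed simp

lemma summation_by_parts_bound:
  fixes w u :: "nat \<Rightarrow> real"
  assumes "m0 \<le> m1" and w: "\<And>t. t \<ge> m0 \<Longrightarrow> w t \<ge> 0"
    and \<gamma>: "\<gamma> \<ge> 0" "\<And>t. t \<ge> m0 \<Longrightarrow> \<bar>w (Suc t) - w t\<bar> \<le> \<gamma> * w (Suc t)"
  shows "(\<Sum>t=m0..<m1. w t * (fd 1 u t)\<^sup>2) \<le>
    (1 + \<gamma>) * (w m1 * (\<bar>u m1\<bar> * \<bar>fd 1 u m1\<bar>)) + w m0 * (\<bar>u m0\<bar> * \<bar>fd 1 u m0\<bar>)
    + \<gamma> * (\<Sum>t=m0..<m1. w t * (\<bar>u t\<bar> * \<bar>fd 1 u t\<bar>))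
    + (\<Sum>t=m0..<m1. w t * (\<bar>u (Suc t)\<bar> * \<bar>fd 2 u t\<bar>))"
proof -
  let ?\<phi> = "\<lambda>t. \<bar>u t\<bar> * \<bar>fd 1 u t\<bar>"
  have 1: "w m1 * (u m1 * fd 1 u m1) \<le> w m1 * ?\<phi> m1"
    using w[of m1] assms(1) by (intro mult_left_mono) (auto simp flip: abs_mult)
  have 2: "- (w m0 * (u m0 * fd 1 u m0)) \<le> w m0 * ?\<phi> m0"
    using w[of m0] abs_ge_minus_self[of "u m0 * fd 1 u m0"]
    unfolding mult_minus_right[symmetric] abs_mult by (intro mult_left_mono) auto
  have "- (\<Sum>t=m0..<m1. (w (Suc t) - w t) * (u (Suc t) * fd 1 u (Suc t)))
      \<le> (\<Sum>t=m0..<m1. \<bar>(w (Suc t) - w t) * (u (Suc t) * fd 1 u (Suc t))\<bar>)"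
    by (rule order_trans[OF abs_ge_minus_self sum_abs])
  also have "\<dots> \<le> (\<Sum>t=m0..<m1. \<gamma> * w (Suc t) * ?\<phi> (Suc t))"
    unfolding abs_mult by (intro sum_mono mult_right_mono \<gamma>) auto
  also have "\<dots> = \<gamma> * (\<Sum>t=m0..<m1. w (Suc t) * ?\<phi> (Suc t))"
    by (simp add: sum_distrib_left mult_ac)
  \<comment> \<open>Measuring the change of weight against \<open>w (Suc t)\<close> lets the sum be
    reindexed to unshifted time. This adds a term at \<open>m1\<close>, hence the factor
    \<open>1 + \<gamma>\<close> there.\<close>
  also have "(\<Sum>t=m0..<m1. w (Suc t) * ?\<phi> (Suc t)) = (\<Sum>t=m0..<m1. w t * ?\<phi> t) + w m1 * ?\<phi> m1 - w m0 * ?\<phi> m0"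
    using sum_Suc_diff'[OF assms(1), of "\<lambda>t. w t * ?\<phi> t"] by (simp add: sum_subtractf)
  also have "\<gamma> * \<dots> \<le> \<gamma> * ((\<Sum>t=m0..<m1. w t * ?\<phi> t) + w m1 * ?\<phi> m1)"
    using \<gamma> w[of m0] by (intro mult_left_mono) auto
  finally have 3: "- (\<Sum>t=m0..<m1. (w (Suc t) - w t) * (u (Suc t) * fd 1 u (Suc t))) \<le> \<dots>" .
  have "- (\<Sum>t=m0..<m1. w t * (u (Suc t) * fd 2 u t)) \<le> (\<Sum>t=m0..<m1. \<bar>w t * (u (Suc t) * fd 2 u t)\<bar>)"
    by (rule order_trans[OF abs_ge_minus_self sum_abs])
  also have "\<dots> = (\<Sum>t=m0..<m1. w t * (\<bar>u (Suc t)\<bar> * \<bar>fd 2 u t\<bar>))"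
    using w by (intro sum.cong) (auto simp: abs_mult)
  finally show ?thesis
    using summation_by_parts[OF assms(1), of w u] 1 2 3
    unfolding distrib_left distrib_right mult_1 by linarith
qed

lemma weighted_Cauchy_Schwarz:
  fixes w f g :: "'b \<Rightarrow> real"
  assumes "\<And>z. z \<in> Z \<Longrightarrow> w z \<ge> 0"
  shows "(\<Sum>z\<in>Z. w z * (\<bar>f z\<bar> * \<bar>g z\<bar>)) \<le> sqrt ((\<Sum>z\<in>Z. w z * (f z)\<^sup>2) * (\<Sum>z\<in>Z. w z * (g z)\<^sup>2))"
proof -
  have "(\<Sum>z\<in>Z. w z * (\<bar>f z\<bar> * \<bar>g z\<bar>)) = (\<Sum>z\<in>Z. \<bar>sqrt (w z) * f z\<bar> * \<bar>sqrt (w z) * g z\<bar>)"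
  proof (rule sum.cong[OF refl])
    fix z assume "z \<in> Z"
    then have w: "w z \<ge> 0" by (rule assms)
    then have "\<bar>sqrt (w z) * f z\<bar> * \<bar>sqrt (w z) * g z\<bar> = (sqrt (w z) * sqrt (w z)) * (\<bar>f z\<bar> * \<bar>g z\<bar>)"
      by (simp add: abs_mult)
    then show "w z * (\<bar>f z\<bar> * \<bar>g z\<bar>) = \<bar>sqrt (w z) * f z\<bar> * \<bar>sqrt (w z) * g z\<bar>"
      using w by simp
  qed
  also have "\<dots> \<le> L2_set (\<lambda>z. sqrt (w z) * f z) Z * L2_set (\<lambda>z. sqrt (w z) * g z) Z"
    by (rule L2_set_mult_ineq)
  also have "\<dots> = sqrt ((\<Sum>z\<in>Z. w z * (f z)\<^sup>2) * (\<Sum>z\<in>Z. w z * (g z)\<^sup>2))"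
    using assms by (simp add: L2_set_def real_sqrt_mult power_mult_distrib cong: sum.cong)
  finally show ?thesis .
qed

text \<open>Cauchy-Schwarz in the plane. It will merge the padding sequence with the energies under
  one square root.\<close>

lemma sqrt_mult_add_le:
  fixes a b c d :: real
  assumes "a \<ge> 0" "b \<ge> 0" "c \<ge> 0" "d \<ge> 0"
  shows "sqrt (a * b) + sqrt (c * d) \<le> sqrt ((a + c) * (b + d))"
proof (rule real_le_rsqrt)
  have "2 * (sqrt (a * d) * sqrt (c * b)) \<le> (sqrt (a * d))\<^sup>2 + (sqrt (c * b))\<^sup>2"
    using sum_squares_bound[of "sqrt (a * d)" "sqrt (c * b)"] by simp
  then show "(sqrt (a * b) + sqrt (c * d))\<^sup>2 \<le> (a + c) * (b + d)"
    using assms by (simp add: power2_sum real_sqrt_mult algebra_simps)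
qed

text \<open>The hypothesis is near log-convexity, so the successive ratios \<open>\<rho>\<close>
  almost increase. Tracking \<open>1 + \<rho>\<close> instead of \<open>\<rho>\<close> turns the
  additive error \<open>12 * \<eta>\<close> into a multiplicative one: a factor
  \<open>1 - 14 * \<eta>\<close> per order.\<close>

lemma ratio_persistence:
  fixes R :: "nat \<Rightarrow> real"
  assumes R: "\<And>k. R k > 0" and \<eta>: "0 < \<eta>" "84 * (\<eta> * real h) \<le> 1"
    and step: "\<And>k. k + 2 \<le> h \<Longrightarrow>
      (1 - \<eta>) * (R (k + 1))\<^sup>2 \<le> 12 * \<eta> * (R k * R (k + 1)) + (1 + 13 * \<eta>) * (R k * R (k + 2))"
    and "R 0 \<le> 2 * R 1"
  shows "R 0 \<le> 4 ^ h * R h"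
proof -
  define \<rho> where "\<rho> k = R (k + 1) / R k" for k
  have \<rho>: "\<rho> k > 0" for k using R by (simp add: \<rho>_def)
  have \<rho>_step: "(1 - 14 * \<eta>) * (1 + \<rho> k) \<le> 1 + \<rho> (k + 1)" if "k + 2 \<le> h" for k
  proof -
    have "(1 - \<eta>) * (R (k + 1))\<^sup>2 / (R k * R (k + 1))
       \<le> (12 * \<eta> * (R k * R (k + 1)) + (1 + 13 * \<eta>) * (R k * R (k + 2))) / (R k * R (k + 1))"
      using R by (intro divide_right_mono step[OF that]) (auto intro!: mult_nonneg_nonneg less_imp_le)
    then have "(1 - \<eta>) * \<rho> k \<le> 12 * \<eta> + (1 + 13 * \<eta>) * \<rho> (k + 1)"
      using R[of k] R[of "k + 1"] by (simp add: \<rho>_def power2_eq_square add_divide_distrib)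
    moreover have "(1 - 14 * \<eta>) * (1 + 13 * \<eta>) * \<rho> k \<le> (1 - \<eta>) * \<rho> k"
      using \<rho>[of k] by (intro mult_right_mono) (auto simp: algebra_simps)
    moreover have "(1 + 13 * \<eta>) * (1 + \<rho> (k + 1) - (1 - 14 * \<eta>) * (1 + \<rho> k))
      = (12 * \<eta> + (1 + 13 * \<eta>) * \<rho> (k + 1)) - (1 - 14 * \<eta>) * (1 + 13 * \<eta>) * \<rho> k + 2 * \<eta> + 182 * \<eta>\<^sup>2"
      by (simp add: algebra_simps power2_eq_square)
    ultimately have "0 \<le> (1 + 13 * \<eta>) * (1 + \<rho> (k + 1) - (1 - 14 * \<eta>) * (1 + \<rho> k))"
      using \<eta> by (smt (verit) zero_le_power2)
    then show ?thesis using \<eta> by (simp add: zero_le_mult_iff)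
  qed
  have "1 / 2 \<le> \<rho> 0" using assms(5) R[of 0] by (simp add: \<rho>_def field_simps)
  have \<rho>_lower: "\<rho> k \<ge> 1 / 4" if "k + 1 \<le> h" for k
  proof -
    have "\<eta> * 1 \<le> \<eta> * real h" using \<eta> that by (intro mult_left_mono) auto
    then have \<eta>1: "84 * \<eta> \<le> 1" using \<eta> by linarith
    have "(1 - 14 * \<eta>) ^ k * (3 / 2) \<le> 1 + \<rho> k"
      using that
    proof (induction k)
      case (Suc k)
      have "(1 - 14 * \<eta>) * ((1 - 14 * \<eta>) ^ k * (3 / 2)) \<le> (1 - 14 * \<eta>) * (1 + \<rho> k)"
        using Suc \<eta>1 by (intro mult_left_mono) auto
      also have "\<dots> \<le> 1 + \<rho> (k + 1)" using Suc by (intro \<rho>_step) auto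
      finally show ?case by (simp add: mult.assoc)
    qed (use \<open>1 / 2 \<le> \<rho> 0\<close> in simp)
    \<comment> \<open>The total loss over at most \<open>h\<close> orders is
      \<open>14 / 84 = 1 / 6\<close>, and \<open>3 / 2 * (5 / 6) - 1 = 1 / 4\<close>.\<close>
    moreover have "1 - 14 * (\<eta> * real k) \<le> (1 - 14 * \<eta>) ^ k"
      using Bernoulli_inequality[of "- (14 * \<eta>)" k] \<eta>1 by (simp add: mult_ac)
    moreover have "\<eta> * real k \<le> \<eta> * real h" using \<eta> that by (intro mult_left_mono) auto
    ultimately show ?thesis using \<eta>(2) by linarith
  qed
  have "R 0 \<le> 4 ^ k * R k" if "k \<le> h" for k
    using that
  proof (induction k)
    case (Suc k)
    have "R k \<le> 4 * R (Suc k)" using \<rho>_lower[of k] Suc.prems R[of k] by (simp add: \<rho>_def field_simps)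
    have "R 0 \<le> 4 ^ k * R k" using Suc by simp
    also have "\<dots> \<le> 4 ^ k * (4 * R (Suc k))" using \<open>R k \<le> 4 * R (Suc k)\<close> by (rule mult_left_mono) simp
    finally show ?case by (simp only: power_Suc2 mult.assoc)
  qed simp
  then show ?thesis by simp
qed

text \<open>In the application \<open>P\<close> consists of pairs of actions, \<open>w t\<close> is
  half the product of their probabilities in round \<open>t + 1\<close>, and \<open>F\<close> is the
  difference of their losses; weighted sums of squares are then variances.\<close>

locale slow_weights =
  fixes P :: "'p set" and w :: "nat \<Rightarrow> 'p \<Rightarrow> real" and F :: "'p \<Rightarrow> nat \<Rightarrow> real"
    and m0 m1 h :: nat and \<eta> :: real
  assumes finite_P: "finite P" and m: "m0 \<le> m1"
    and \<eta>: "0 < \<eta>" "1 \<le> h" "84 * (\<eta> * real h) \<le> 1"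
    and w_nonneg: "\<And>t p. t \<ge> m0 \<Longrightarrow> p \<in> P \<Longrightarrow> w t p \<ge> 0"
    and w_sum: "\<And>t. t \<ge> m0 \<Longrightarrow> (\<Sum>p\<in>P. w t p) \<le> 1"
    and w_slow: "\<And>t p. t \<ge> m0 \<Longrightarrow> p \<in> P \<Longrightarrow> \<bar>w (Suc t) p - w t p\<bar> \<le> 12 * \<eta> * w (Suc t) p"
      "\<And>t p. t \<ge> m0 \<Longrightarrow> p \<in> P \<Longrightarrow> w t p \<le> (1 + 12 * \<eta>) * w (Suc t) p"
    and F_bound: "\<And>k t p. k \<le> h \<Longrightarrow> t \<ge> m0 \<Longrightarrow> p \<in> P \<Longrightarrow> \<bar>fd k (F p) t\<bar> \<le> 2 * (1 / 8) ^ k"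
begin

text \<open>
  In \<open>energy\<close> the weight of round \<open>t\<close> multiplies the forward difference of order \<open>k\<close> at \<open>t\<close>, so data
  from rounds up to \<open>m1 + k\<close> enter; the dynamics are defined beyond any horizon.
\<close>

definition energy :: "nat \<Rightarrow> real" where
  "energy k = (\<Sum>z\<in>{m0..<m1} \<times> P. w (fst z) (snd z) * (fd k (F (snd z)) (fst z))\<^sup>2)"

lemma sum_time_pairs: "(\<Sum>z\<in>{m0..<m1} \<times> P. G (fst z) (snd z)) = (\<Sum>p\<in>P. \<Sum>t=m0..<m1. G t p)"
  for G :: "nat \<Rightarrow> 'p \<Rightarrow> real"
  by (subst sum.swap) (simp add: sum.cartesian_product case_prod_beta)

lemma w_nonneg_pairs: "z \<in> {m0..<m1} \<times> P \<Longrightarrow> w (fst z) (snd z) \<ge> 0"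
  using w_nonneg by auto

lemma energy_nonneg: "energy k \<ge> 0"
  unfolding energy_def by (intro sum_nonneg mult_nonneg_nonneg w_nonneg_pairs) auto

lemma \<eta>_small: "84 * \<eta> \<le> 1"
proof -
  have "\<eta> * 1 \<le> \<eta> * real h" using \<eta> by (intro mult_left_mono) auto
  then show ?thesis using \<eta> by linarith
qed

lemma weighted_sum_le:
  assumes "t \<ge> m0" "\<And>p. p \<in> P \<Longrightarrow> g p \<le> c" "c \<ge> 0"
  shows "(\<Sum>p\<in>P. w t p * g p) \<le> c"
proof -
  have "(\<Sum>p\<in>P. w t p * g p) \<le> (\<Sum>p\<in>P. w t p * c)"
    using assms w_nonneg by (intro sum_mono mult_left_mono) auto
  also have "\<dots> \<le> 1 * c"
    unfolding sum_distrib_right[symmetric] using assms w_sum by (intro mult_right_mono) auto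
  finally show ?thesis by simp
qed

lemma F_square_bound:
  assumes "k \<le> h" "t \<ge> m0" "p \<in> P"
  shows "(fd k (F p) t)\<^sup>2 \<le> 4 * (1 / 64) ^ k"
proof -
  have "(fd k (F p) t)\<^sup>2 \<le> (2 * (1 / 8) ^ k)\<^sup>2"
    using F_bound[OF assms] abs_le_square_iff[of "fd k (F p) t" "2 * (1 / 8) ^ k"] by simp
  also have "\<dots> = 4 * (1 / 64) ^ k"
    by (simp add: power_mult_distrib power2_eq_square power_divide flip: power_mult)
      (simp add: power_mult_distrib[symmetric])
  finally show ?thesis .
qed

lemma energy_le: "k \<le> h \<Longrightarrow> energy k \<le> 4 * (real (m1 - m0) * (1 / 64) ^ k)"
proof -
  assume k: "k \<le> h"
  have "energy k = (\<Sum>t=m0..<m1. \<Sum>p\<in>P. w t p * (fd k (F p) t)\<^sup>2)"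
    unfolding energy_def by (simp add: sum.cartesian_product case_prod_beta)
  also have "\<dots> \<le> (\<Sum>t=m0..<m1. 4 * (1 / 64) ^ k)"
    using F_square_bound[OF k] by (intro sum_mono weighted_sum_le) auto
  finally show ?thesis by (simp add: mult_ac)
qed

text \<open>Moving the weight to the round of the shifted difference costs the factor
  \<open>1 + 12 * \<eta>\<close>; reindexing then trades the term at \<open>m0\<close> for one at
  \<open>m1\<close>, which the smoothness bound controls.\<close>

lemma shifted_energy_le:
  assumes "k \<le> h"
  shows "(\<Sum>z\<in>{m0..<m1} \<times> P. w (fst z) (snd z) * (fd k (F (snd z)) (Suc (fst z)))\<^sup>2)
    \<le> (1 + 12 * \<eta>) * (energy k + 4 * (1 / 64) ^ k)"
proof -
  let ?g = "\<lambda>t p. w t p * (fd k (F p) t)\<^sup>2"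
  have "(\<Sum>z\<in>{m0..<m1} \<times> P. w (fst z) (snd z) * (fd k (F (snd z)) (Suc (fst z)))\<^sup>2)
     \<le> (\<Sum>z\<in>{m0..<m1} \<times> P. (1 + 12 * \<eta>) * w (Suc (fst z)) (snd z) * (fd k (F (snd z)) (Suc (fst z)))\<^sup>2)"
    using w_slow(2) by (intro sum_mono mult_right_mono) auto
  also have "\<dots> = (1 + 12 * \<eta>) * (\<Sum>p\<in>P. \<Sum>t=m0..<m1. ?g (Suc t) p)"
    unfolding mult.assoc sum_distrib_left[symmetric] sum_time_pairs[of "\<lambda>t. ?g (Suc t)"] ..
  also have "\<dots> \<le> (1 + 12 * \<eta>) * (\<Sum>p\<in>P. (\<Sum>t=m0..<m1. ?g t p) + ?g m1 p)"
  proof (intro mult_left_mono sum_mono)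
    fix p assume p: "p \<in> P"
    have "(\<Sum>t=m0..<m1. ?g (Suc t) p) - (\<Sum>t=m0..<m1. ?g t p) = ?g m1 p - ?g m0 p"
      using sum_Suc_diff'[OF m, of "\<lambda>t. ?g t p"] by (simp add: sum_subtractf)
    moreover have "?g m0 p \<ge> 0" using w_nonneg[OF _ p, of m0] by simp
    ultimately show "(\<Sum>t=m0..<m1. ?g (Suc t) p) \<le> (\<Sum>t=m0..<m1. ?g t p) + ?g m1 p" by linarith
  qed (use \<eta> in auto)
  also have "(\<Sum>p\<in>P. (\<Sum>t=m0..<m1. ?g t p) + ?g m1 p) = energy k + (\<Sum>p\<in>P. ?g m1 p)"
    unfolding energy_def sum_time_pairs[of ?g] sum.distrib ..
  also have "(1 + 12 * \<eta>) * \<dots> \<le> (1 + 12 * \<eta>) * (energy k + 4 * (1 / 64) ^ k)"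
    using \<eta> m F_square_bound[OF assms] by (intro mult_left_mono add_left_mono weighted_sum_le) auto
  finally show ?thesis .
qed

text \<open>Summation by parts replaces a squared difference of order \<open>k + 1\<close> by a
  product of orders \<open>k\<close> and \<open>k + 2\<close>; Cauchy-Schwarz over rounds and pairs
  jointly then gives near log-convexity. The slow weights contribute the term with
  \<open>12 * \<eta>\<close>.\<close>

lemma energy_recurrence:
  assumes k: "k + 2 \<le> h"
  shows "energy (k + 1) \<le> 96 * (1 / 64) ^ (k + 1) + 12 * \<eta> * sqrt (energy k * energy (k + 1))
    + sqrt ((1 + 12 * \<eta>) * (energy k + 4 * (1 / 64) ^ k) * energy (k + 2))"
proof -
  let ?Z = "{m0..<m1} \<times> P"
  let ?D = "\<lambda>l p. fd (k + l) (F p)"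
  have D: "fd l (fd k (F p)) t = fd (k + l) (F p) t" for l p t
    by (induction l arbitrary: t) auto
  have boundary: "(\<Sum>p\<in>P. w t p * (\<bar>?D 0 p t\<bar> * \<bar>?D 1 p t\<bar>)) \<le> 32 * (1 / 64) ^ (k + 1)" if t: "t \<ge> m0" for t
  proof (rule weighted_sum_le[OF t])
    fix p assume "p \<in> P"
    then have "\<bar>?D 0 p t\<bar> * \<bar>?D 1 p t\<bar> \<le> (2 * (1 / 8) ^ k) * (2 * (1 / 8) ^ (k + 1))"
      using k t F_bound[of "k + 0" t p] F_bound[of "k + 1" t p] by (intro mult_mono) auto
    also have "\<dots> = 32 * (1 / 64) ^ (k + 1)"
      by (simp flip: power_mult_distrib)
    finally show "\<bar>?D 0 p t\<bar> * \<bar>?D 1 p t\<bar> \<le> 32 * (1 / 64) ^ (k + 1)" .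
  qed auto
  have "energy (k + 1) = (\<Sum>p\<in>P. \<Sum>t=m0..<m1. w t p * (?D 1 p t)\<^sup>2)"
    unfolding energy_def by (rule sum_time_pairs[of "\<lambda>t p. w t p * (?D 1 p t)\<^sup>2"])
  also have "\<dots> \<le> (\<Sum>p\<in>P. (1 + 12 * \<eta>) * (w m1 p * (\<bar>?D 0 p m1\<bar> * \<bar>?D 1 p m1\<bar>))
      + w m0 p * (\<bar>?D 0 p m0\<bar> * \<bar>?D 1 p m0\<bar>)
      + 12 * \<eta> * (\<Sum>t=m0..<m1. w t p * (\<bar>?D 0 p t\<bar> * \<bar>?D 1 p t\<bar>))
      + (\<Sum>t=m0..<m1. w t p * (\<bar>?D 0 p (Suc t)\<bar> * \<bar>?D 2 p t\<bar>)))"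
  proof (rule sum_mono)
    fix p assume p: "p \<in> P"
    have "0 \<le> 12 * \<eta>" using \<eta> by simp
    from summation_by_parts_bound[OF m, of "\<lambda>t. w t p" "12 * \<eta>" "fd k (F p)",
        OF w_nonneg[OF _ p] this w_slow(1)[OF _ p]]
    show "(\<Sum>t=m0..<m1. w t p * (?D 1 p t)\<^sup>2) \<le> (1 + 12 * \<eta>) * (w m1 p * (\<bar>?D 0 p m1\<bar> * \<bar>?D 1 p m1\<bar>))
      + w m0 p * (\<bar>?D 0 p m0\<bar> * \<bar>?D 1 p m0\<bar>)
      + 12 * \<eta> * (\<Sum>t=m0..<m1. w t p * (\<bar>?D 0 p t\<bar> * \<bar>?D 1 p t\<bar>))
      + (\<Sum>t=m0..<m1. w t p * (\<bar>?D 0 p (Suc t)\<bar> * \<bar>?D 2 p t\<bar>))"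
      by (simp only: D add_0_right)
  qed
  also have "\<dots> = (1 + 12 * \<eta>) * (\<Sum>p\<in>P. w m1 p * (\<bar>?D 0 p m1\<bar> * \<bar>?D 1 p m1\<bar>))
      + (\<Sum>p\<in>P. w m0 p * (\<bar>?D 0 p m0\<bar> * \<bar>?D 1 p m0\<bar>))
      + 12 * \<eta> * (\<Sum>z\<in>?Z. w (fst z) (snd z) * (\<bar>?D 0 (snd z) (fst z)\<bar> * \<bar>?D 1 (snd z) (fst z)\<bar>))
      + (\<Sum>z\<in>?Z. w (fst z) (snd z) * (\<bar>?D 0 (snd z) (Suc (fst z))\<bar> * \<bar>?D 2 (snd z) (fst z)\<bar>))"
    unfolding sum_time_pairs[of "\<lambda>t p. w t p * (\<bar>?D 0 p t\<bar> * \<bar>?D 1 p t\<bar>)"]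
      sum_time_pairs[of "\<lambda>t p. w t p * (\<bar>?D 0 p (Suc t)\<bar> * \<bar>?D 2 p t\<bar>)"]
      sum.distrib sum_distrib_left[symmetric] ..
  \<comment> \<open>The upper boundary term counts twice because
    \<open>1 + 12 * \<eta> \<le> 2\<close>; with the lower one this makes
    \<open>96 = 3 * 32\<close>.\<close>
  also have "\<dots> \<le> 2 * (32 * (1 / 64) ^ (k + 1)) + 32 * (1 / 64) ^ (k + 1)
      + 12 * \<eta> * sqrt (energy k * energy (k + 1))
      + sqrt ((1 + 12 * \<eta>) * (energy k + 4 * (1 / 64) ^ k) * energy (k + 2))"
  proof (intro add_mono mult_left_mono)
    have "(\<Sum>p\<in>P. w m1 p * (\<bar>?D 0 p m1\<bar> * \<bar>?D 1 p m1\<bar>)) \<ge> 0"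
      using m by (intro sum_nonneg mult_nonneg_nonneg w_nonneg) auto
    then show "(1 + 12 * \<eta>) * (\<Sum>p\<in>P. w m1 p * (\<bar>?D 0 p m1\<bar> * \<bar>?D 1 p m1\<bar>)) \<le> 2 * (32 * (1 / 64) ^ (k + 1))"
      using \<eta>_small m by (intro mult_mono boundary) auto
    show "(\<Sum>z\<in>?Z. w (fst z) (snd z) * (\<bar>?D 0 (snd z) (fst z)\<bar> * \<bar>?D 1 (snd z) (fst z)\<bar>))
        \<le> sqrt (energy k * energy (k + 1))"
      using weighted_Cauchy_Schwarz[OF w_nonneg_pairs, of "{m0..<m1} \<times> P" "\<lambda>z. z"
          "\<lambda>z. ?D 0 (snd z) (fst z)" "\<lambda>z. ?D 1 (snd z) (fst z)"]
      by (simp add: energy_def)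
    have "(\<Sum>z\<in>?Z. w (fst z) (snd z) * (\<bar>?D 0 (snd z) (Suc (fst z))\<bar> * \<bar>?D 2 (snd z) (fst z)\<bar>))
        \<le> sqrt ((\<Sum>z\<in>?Z. w (fst z) (snd z) * (?D 0 (snd z) (Suc (fst z)))\<^sup>2) * energy (k + 2))"
      unfolding energy_def by (intro weighted_Cauchy_Schwarz w_nonneg_pairs)
    also have "\<dots> \<le> sqrt ((1 + 12 * \<eta>) * (energy k + 4 * (1 / 64) ^ k) * energy (k + 2))"
      using k shifted_energy_le[of k] energy_nonneg by (intro real_sqrt_le_mono mult_right_mono) auto
    finally show "(\<Sum>z\<in>?Z. w (fst z) (snd z) * (\<bar>?D 0 (snd z) (Suc (fst z))\<bar> * \<bar>?D 2 (snd z) (fst z)\<bar>))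
        \<le> sqrt ((1 + 12 * \<eta>) * (energy k + 4 * (1 / 64) ^ k) * energy (k + 2))" .
  qed (use \<eta> boundary[of m0] in auto)
  finally show ?thesis by simp
qed

text \<open>
  Adding the geometric sequence \<open>pad\<close> to the energies absorbs the boundary terms of the summation by
  parts. It costs \<open>96 / \<eta>\<close> at order \<open>0\<close>, which is a constant in the regret.
\<close>

definition pad :: "nat \<Rightarrow> real" where
  "pad k = 96 / \<eta> * (1 / 64) ^ k"

lemma pad_pos: "pad k > 0"
  using \<eta> by (simp add: pad_def)

lemma padded_recurrence:
  assumes k: "k + 2 \<le> h"
  defines "A \<equiv> \<lambda>k. energy k + pad k"
  shows "(1 - \<eta>) * A (k + 1) \<le> 12 * \<eta> * sqrt (A k * A (k + 1)) + (1 + 13 * \<eta>) * sqrt (A k * A (k + 2))"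
proof -
  note nonneg = energy_nonneg less_imp_le[OF pad_pos]
  have \<eta>0: "0 \<le> \<eta>" using \<eta> by simp
  have A: "A k \<ge> 0" for k unfolding A_def using nonneg by (intro add_nonneg_nonneg)
  \<comment> \<open>The factor \<open>96 / \<eta>\<close> in \<open>pad\<close> is chosen so that
    \<open>\<eta> * pad (k + 1)\<close> equals the boundary term.\<close>
  have 1: "96 * (1 / 64) ^ (k + 1) \<le> \<eta> * A (k + 1)"
    using \<eta> energy_nonneg[of "k + 1"] by (simp add: A_def pad_def field_simps)
  have 2: "sqrt (energy k * energy (k + 1)) \<le> sqrt (A k * A (k + 1))"
    unfolding A_def using nonneg by (intro real_sqrt_le_mono mult_mono add_increasing2 add_nonneg_nonneg order.refl)
  \<comment> \<open>A geometric sequence satisfies the log-convexity relation with equality, so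
    adding it preserves the recurrence by \<open>sqrt_mult_add_le\<close>.\<close>
  have "(pad (k + 1))\<^sup>2 = pad k * pad (k + 2)"
    by (simp add: pad_def power2_eq_square)
  then have pad_eq: "pad (k + 1) = sqrt (pad k * pad (k + 2))"
    using pad_pos[of "k + 1"] by (metis less_imp_le real_sqrt_unique)
  let ?e = "(1 + 12 * \<eta>) * (energy k + 4 * (1 / 64) ^ k)"
  have e: "?e \<ge> 0" using \<eta>0 energy_nonneg by (intro mult_nonneg_nonneg add_nonneg_nonneg) auto
  have "4 * (1 / 64) ^ k \<le> \<eta> * pad k" using \<eta> by (simp add: pad_def)
  then have "?e + pad k \<le> (1 + 12 * \<eta>) * (energy k + \<eta> * pad k) + pad k"
    using \<eta>0 by (intro add_right_mono mult_left_mono) auto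
  also have "\<dots> \<le> (1 + 13 * \<eta>)\<^sup>2 * A k"
  proof -
    have "(1 + 13 * \<eta>)\<^sup>2 * A k - ((1 + 12 * \<eta>) * (energy k + \<eta> * pad k) + pad k)
        = (14 * \<eta> + 169 * \<eta>\<^sup>2) * energy k + (25 * \<eta> + 157 * \<eta>\<^sup>2) * pad k"
      by (simp add: A_def algebra_simps power2_eq_square)
    moreover have "\<dots> \<ge> 0" using \<eta>0 nonneg by (intro add_nonneg_nonneg mult_nonneg_nonneg) auto
    ultimately show ?thesis by linarith
  qed
  finally have 3: "?e + pad k \<le> (1 + 13 * \<eta>)\<^sup>2 * A k" .
  have "sqrt (?e * energy (k + 2)) + pad (k + 1) \<le> sqrt ((?e + pad k) * A (k + 2))"
    unfolding pad_eq A_def using e nonneg by (intro sqrt_mult_add_le) auto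
  also have "\<dots> \<le> sqrt ((1 + 13 * \<eta>)\<^sup>2 * A k * A (k + 2))"
    using 3 A by (intro real_sqrt_le_mono mult_right_mono) auto
  also have "\<dots> = (1 + 13 * \<eta>) * sqrt (A k * A (k + 2))"
    using \<eta>0 by (simp add: real_sqrt_mult)
  finally have 4: "sqrt (?e * energy (k + 2)) + pad (k + 1) \<le> (1 + 13 * \<eta>) * sqrt (A k * A (k + 2))" .
  have "12 * \<eta> * sqrt (energy k * energy (k + 1)) \<le> 12 * \<eta> * sqrt (A k * A (k + 1))"
    using 2 \<eta>0 by (intro mult_left_mono) auto
  then have "A (k + 1) \<le> \<eta> * A (k + 1) + 12 * \<eta> * sqrt (A k * A (k + 1)) + (1 + 13 * \<eta>) * sqrt (A k * A (k + 2))"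
    using energy_recurrence[OF k] 1 4 by (simp only: A_def)
  then show ?thesis by (simp add: algebra_simps)
qed

text \<open>Either the padded energies already drop by a factor 4, and only a quarter of
  \<open>pad 0\<close> is paid, or the ratios stay above \<open>1 / 16\<close> up to order
  \<open>h\<close>. In the second case the smoothness bound at order \<open>h\<close> decays like
  \<open>64 ^ h\<close> against a growth of at most \<open>16 ^ h\<close>, so
  \<open>energy 0\<close> is of order \<open>(m1 - m0) / 4 ^ h\<close> and \<open>energy 1\<close>
  follows it.\<close>

lemma first_difference_energy:
  "energy 1 \<le> energy 0 / 4 + 24 / \<eta> + 30 * (real (m1 - m0) * exp (- real h))"
proof -
  define A where "A k = energy k + pad k" for k
  have A: "A k > 0" for k
    using energy_nonneg[of k] pad_pos[of k] by (simp add: A_def)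
  show ?thesis
  proof (cases "A 1 \<le> A 0 / 4")
    case True
    then have "energy 1 \<le> energy 0 / 4 + pad 0 / 4" using pad_pos[of 1] by (simp add: A_def)
    also have "pad 0 / 4 = 24 / \<eta>" by (simp add: pad_def)
    finally show ?thesis by (smt (verit) exp_gt_zero of_nat_0_le_iff mult_nonneg_nonneg)
  next
    case False
    define R where "R k = sqrt (A k)" for k
    have "sqrt (A 0) \<le> sqrt (4 * A 1)" using False by (intro real_sqrt_le_mono) auto
    then have "R 0 \<le> 2 * R 1" by (simp add: R_def real_sqrt_mult)
    moreover have "(1 - \<eta>) * (R (k + 1))\<^sup>2 \<le> 12 * \<eta> * (R k * R (k + 1)) + (1 + 13 * \<eta>) * (R k * R (k + 2))"
      if "k + 2 \<le> h" for k
      using padded_recurrence[OF that] A[of "k + 1"] by (simp add: R_def A_def real_sqrt_mult)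
    ultimately have "R 0 \<le> 4 ^ h * R h"
      using A \<eta> by (intro ratio_persistence[of R \<eta> h]) (auto simp: R_def)
    then have "(R 0)\<^sup>2 \<le> (4 ^ h * R h)\<^sup>2"
      using A[of 0] by (intro power_mono) (auto simp: R_def)
    then have "A 0 \<le> 16 ^ h * A h"
      using A[of 0] A[of h] by (simp add: R_def power_mult_distrib flip: power_mult)
        (simp add: power_mult mult.commute[of h])
    \<comment> \<open>The padding at order \<open>h\<close> is absorbed by the left side: it shrinks
      by 64 per order, and \<open>h \<ge> 1\<close> leaves at least a factor 4.\<close>
    moreover have "16 ^ h * pad h \<le> A 0 / 4"
    proof -
      have "16 ^ h * pad h = pad 0 * (1 / 4) ^ h"
        by (simp add: pad_def flip: power_mult_distrib)
      also have "\<dots> \<le> A 0 * (1 / 4) ^ 1"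
        using energy_nonneg[of 0] \<eta> A[of 0] by (intro mult_mono power_decreasing) (auto simp: A_def)
      finally show ?thesis by simp
    qed
    moreover have "16 ^ h * energy h \<le> 16 ^ h * (4 * (real (m1 - m0) * (1 / 64) ^ h))"
      by (intro mult_left_mono energy_le) auto
    moreover have "16 ^ h * (4 * (real (m1 - m0) * (1 / 64) ^ h)) = 4 * (real (m1 - m0) * (1 / 4) ^ h)"
      by (simp flip: power_mult_distrib)
    moreover have "real (m1 - m0) * (1 / 4) ^ h \<le> real (m1 - m0) * exp (- real h)"
    proof (intro mult_left_mono)
      have "(1 / 4 :: real) \<le> exp (- 1)"
        using exp_le by (simp add: exp_minus field_simps)
      then have "(1 / 4 :: real) ^ h \<le> exp (- 1) ^ h" by (intro power_mono) auto
      then show "(1 / 4 :: real) ^ h \<le> exp (- real h)" by (simp flip: exp_of_nat_mult)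
    qed auto
    ultimately have "A 0 * 3 / 4 \<le> 4 * (real (m1 - m0) * exp (- real h))"
      by (simp add: A_def[of h] distrib_left)
    then have e0: "energy 0 * 3 \<le> 16 * (real (m1 - m0) * exp (- real h))"
      using pad_pos[of 0] by (simp add: A_def)
    let ?Z = "{m0..<m1} \<times> P"
    \<comment> \<open>Crude comparison with \<open>energy 0\<close> by
      \<open>(a - b)\<^sup>2 \<le> 2 * a\<^sup>2 + 2 * b\<^sup>2\<close>; the constant that the
      shift leaves is covered by \<open>24 / \<eta>\<close>.\<close>
    have "energy 1 \<le> (\<Sum>z\<in>?Z. w (fst z) (snd z) *
        (2 * (fd 0 (F (snd z)) (Suc (fst z)))\<^sup>2 + 2 * (fd 0 (F (snd z)) (fst z))\<^sup>2))"
      unfolding energy_def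
    proof (intro sum_mono mult_left_mono w_nonneg_pairs)
      fix z :: "nat \<times> 'p"
      show "(fd 1 (F (snd z)) (fst z))\<^sup>2 \<le> 2 * (fd 0 (F (snd z)) (Suc (fst z)))\<^sup>2 + 2 * (fd 0 (F (snd z)) (fst z))\<^sup>2"
        using sum_squares_bound[of "F (snd z) (Suc (fst z))" "- F (snd z) (fst z)"]
        by (simp add: power2_diff)
    qed
    also have "\<dots> = 2 * (\<Sum>z\<in>?Z. w (fst z) (snd z) * (fd 0 (F (snd z)) (Suc (fst z)))\<^sup>2) + 2 * energy 0"
      by (simp add: energy_def distrib_left sum.distrib sum_distrib_left mult_ac)
    also have "\<dots> \<le> 2 * ((1 + 12 * \<eta>) * (energy 0 + 4 * (1 / 64) ^ 0)) + 2 * energy 0"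
      using shifted_energy_le[of 0] by simp
    also have "\<dots> \<le> 2 * ((7 / 6) * (energy 0 + 4)) + 2 * energy 0"
      using \<eta>_small energy_nonneg[of 0] by (intro add_right_mono mult_left_mono mult_mono) auto
    finally have "energy 1 \<le> 13 / 3 * energy 0 + 28 / 3" by (simp add: algebra_simps)
    moreover have "28 / 3 \<le> 24 / \<eta>" using \<eta> \<eta>_small by (simp add: field_simps)
    ultimately show ?thesis using e0 energy_nonneg[of 0] by linarith
  qed
qed

end

subsection \<open>Optimistic Hedge\<close>

text \<open>Losses and logits differ by one order, so consecutive weights must be compared. Their
  ratio is \<open>(m + 1) ^ 3 / ((m + 2) ^ 2 * r)\<close>, smallest at \<open>m = 0\<close>, where
  equality holds.\<close>

lemma bw_Suc_ge:
  assumes "r > 0"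
  shows "bw r m \<le> 4 * r * bw r (Suc m)"
proof -
  have "(real m + 2)\<^sup>2 \<le> (2 * (real m + 1))\<^sup>2" by (intro power_mono) auto
  also have "\<dots> = 4 * ((real m + 1)\<^sup>2 * 1)" by (simp only: power_mult_distrib) simp
  also have "\<dots> \<le> 4 * ((real m + 1)\<^sup>2 * (real m + 1))" by (intro mult_left_mono) auto
  finally have "(real m + 2)\<^sup>2 \<le> 4 * ((real m + 1)\<^sup>2 * (real m + 1))" .
  then have "fact m * ((real m + 2)\<^sup>2 * r ^ m) \<le> fact m * (4 * ((real m + 1)\<^sup>2 * (real m + 1)) * r ^ m)"
    using assms by (intro mult_left_mono mult_right_mono) auto
  then show ?thesis using assms by (simp add: bw_def divide_simps mult_ac add.commute)
    (simp add: algebra_simps)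
qed

text \<open>Since \<open>fact k \<le> k ^ k\<close>, the factorial growth is beaten geometrically as
  long as the order stays below \<open>r / 8\<close>; this determines the number of usable
  differences.\<close>

lemma bw_le_power:
  assumes "r > 0" "k \<le> h" "8 * real h \<le> r"
  shows "8 * bw r k \<le> (1 / 8) ^ k"
proof -
  have "8 * bw r k = fact k / r ^ k / (real k + 1)\<^sup>2" by (simp add: bw_def)
  also have "\<dots> \<le> fact k / r ^ k / 1" using assms(1) by (intro divide_left_mono) auto
  also have "\<dots> \<le> real k ^ k / r ^ k"
    using assms(1) fact_le_power[of k, where 'a=real] by (simp add: divide_right_mono)
  also have "\<dots> = (real k / r) ^ k" by (simp add: power_divide)
  also have "\<dots> \<le> (1 / 8) ^ k"
    using assms by (intro power_mono) (auto simp: field_simps)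
  finally show ?thesis .
qed

text \<open>The variance of \<open>f\<close> under \<open>p\<close>, as half the mean squared
  difference of two independent draws. No mean appears, so differences in time act on the losses
  alone while the weights stay outside.\<close>

definition pair_var :: "'b set \<Rightarrow> ('b \<Rightarrow> real) \<Rightarrow> ('b \<Rightarrow> real) \<Rightarrow> real" where
  "pair_var A p f = (\<Sum>z\<in>A \<times> A. p (fst z) * p (snd z) / 2 * (f (fst z) - f (snd z))\<^sup>2)"

lemma pair_var_eq:
  assumes "(\<Sum>a\<in>A. p a) = 1"
  shows "pair_var A p f = (\<Sum>a\<in>A. p a * (f a - (\<Sum>b\<in>A. p b * f b))\<^sup>2)"
proof -
  define m where "m = (\<Sum>b\<in>A. p b * f b)"
  have "pair_var A p f = (\<Sum>a\<in>A. \<Sum>b\<in>A. p a * p b / 2 * (f a - f b)\<^sup>2)"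
    by (simp add: pair_var_def sum.cartesian_product case_prod_beta)
  also have "\<dots> = (\<Sum>a\<in>A. \<Sum>b\<in>A. (p a * (f a)\<^sup>2) * p b / 2 + p a * (p b * (f b)\<^sup>2) / 2 - (p a * f a) * (p b * f b))"
    by (intro sum.cong refl) (simp add: power2_diff field_simps power2_eq_square)
  also have "\<dots> = (\<Sum>a\<in>A. p a * (f a)\<^sup>2) * (\<Sum>a\<in>A. p a) / 2 + (\<Sum>a\<in>A. p a) * (\<Sum>a\<in>A. p a * (f a)\<^sup>2) / 2 - m * m"
    by (simp add: sum.distrib sum_subtractf sum_product m_def flip: sum_divide_distrib)
  also have "\<dots> = (\<Sum>a\<in>A. p a * (f a)\<^sup>2) - m * m"
    using assms by simp
  also have "\<dots> = (\<Sum>a\<in>A. p a * (f a)\<^sup>2) - 2 * m * (\<Sum>a\<in>A. p a * f a) + m\<^sup>2 * (\<Sum>a\<in>A. p a)"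
    using assms by (simp add: m_def power2_eq_square)
  also have "\<dots> = (\<Sum>a\<in>A. p a * (f a)\<^sup>2 - 2 * m * (p a * f a) + m\<^sup>2 * p a)"
    by (simp add: sum.distrib sum_subtractf sum_distrib_left)
  also have "\<dots> = (\<Sum>a\<in>A. p a * (f a - m)\<^sup>2)"
    by (intro sum.cong refl) (simp add: power2_diff algebra_simps)
  finally show ?thesis by (simp add: m_def)
qed

section \<open>Second-order bounds for the log-moment generating function\<close>

lemma exp_quadratic_bounds:
  fixes z :: real
  assumes "\<bar>z\<bar> \<le> 1 / 10"
  shows "exp z \<le> 1 + z + z\<^sup>2" "1 + z + z\<^sup>2 / 3 \<le> exp z"
proof -
  obtain t where t: "\<bar>t\<bar> \<le> \<bar>z\<bar>" "exp z = (\<Sum>m<2. z ^ m / fact m) + exp t / fact 2 * z ^ 2"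
    using Maclaurin_exp_le[of z 2] by blast
  have e: "exp z = 1 + z + exp t / 2 * z\<^sup>2" using t(2) by (simp add: numeral_2_eq_2)
  have "1 + t \<le> exp t" by (rule exp_ge_add_one_self)
  then have "1 / 3 \<le> exp t / 2" using t assms by linarith
  then have "1 / 3 * z\<^sup>2 \<le> exp t / 2 * z\<^sup>2" by (intro mult_right_mono) auto
  then show "1 + z + z\<^sup>2 / 3 \<le> exp z" using e by simp
  have "1 - t \<le> exp (- t)" using exp_ge_add_one_self[of "- t"] by simp
  then have "1 / 2 \<le> exp (- t)" using t assms by linarith
  then have "exp t \<le> 2" by (simp add: exp_minus field_simps)
  then have "exp t / 2 * z\<^sup>2 \<le> 1 * z\<^sup>2" by (intro mult_right_mono) auto
  then show "exp z \<le> 1 + z + z\<^sup>2" using e by simp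
qed

text \<open>Centring at the mean removes the linear term. The true second-order coefficient is one
  half; the crude values 1 and 1/4 are what later require the first-difference energy to be below a
  quarter of \<open>energy 0\<close>.\<close>

lemma log_mgf_bounds:
  fixes p y :: "'b \<Rightarrow> real"
  assumes p: "\<And>a. a \<in> A \<Longrightarrow> p a \<ge> 0" "(\<Sum>a\<in>A. p a) = 1"
    and y: "\<And>a. a \<in> A \<Longrightarrow> \<bar>y a\<bar> \<le> 1 / 20"
  shows "ln (\<Sum>a\<in>A. p a * exp (y a)) \<le> (\<Sum>a\<in>A. p a * y a) + pair_var A p y" (is ?U)
    and "(\<Sum>a\<in>A. p a * y a) + pair_var A p y / 4 \<le> ln (\<Sum>a\<in>A. p a * exp (y a))" (is ?L)
proof -
  define m where "m = (\<Sum>a\<in>A. p a * y a)"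
  define V where "V = pair_var A p y"
  have V: "V = (\<Sum>a\<in>A. p a * (y a - m)\<^sup>2)" by (simp add: V_def m_def pair_var_eq[OF p(2)])
  have "\<bar>m\<bar> \<le> (\<Sum>a\<in>A. \<bar>p a * y a\<bar>)" unfolding m_def by (rule sum_abs)
  also have "\<dots> \<le> (\<Sum>a\<in>A. p a * (1 / 20))"
  proof (rule sum_mono)
    fix a assume a: "a \<in> A"
    show "\<bar>p a * y a\<bar> \<le> p a * (1 / 20)"
      using mult_left_mono[OF y[OF a] p(1)[OF a]] p(1)[OF a] by (simp only: abs_mult abs_of_nonneg)
  qed
  also have "\<dots> = 1 / 20" using p by (simp flip: sum_divide_distrib)
  finally have z: "\<bar>y a - m\<bar> \<le> 1 / 10" if "a \<in> A" for a using y[OF that] by linarith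
  have centred: "(\<Sum>a\<in>A. p a * (y a - m)) = 0"
    using p by (simp add: right_diff_distrib sum_subtractf m_def flip: sum_distrib_right)
  have V0: "V \<ge> 0" unfolding V using p by (intro sum_nonneg) auto
  have "V \<le> (\<Sum>a\<in>A. p a * (1 / 10)\<^sup>2)"
    unfolding V
  proof (intro sum_mono mult_left_mono p)
    fix a assume "a \<in> A"
    then show "(y a - m)\<^sup>2 \<le> (1 / 10)\<^sup>2"
      using power_mono[OF z abs_ge_zero, of a 2] by (simp only: power2_abs)
  qed
  also have "\<dots> = 1 / 100" using p by (simp flip: sum_divide_distrib add: power2_eq_square)
  finally have V1: "V \<le> 1 / 100" .
  define Z where "Z = (\<Sum>a\<in>A. p a * exp (y a - m))"
  have split: "(\<Sum>a\<in>A. p a * exp (y a)) = exp m * Z"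
    unfolding Z_def sum_distrib_left by (intro sum.cong) (auto simp: exp_diff)
  have "Z \<le> (\<Sum>a\<in>A. p a * (1 + (y a - m) + (y a - m)\<^sup>2))"
    unfolding Z_def using p z by (intro sum_mono mult_left_mono exp_quadratic_bounds) auto
  also have "\<dots> = 1 + V"
    unfolding distrib_left sum.distrib centred V using p by simp
  finally have ZU: "Z \<le> 1 + V" .
  have "1 + V / 3 = (\<Sum>a\<in>A. p a * (1 + (y a - m) + (y a - m)\<^sup>2 / 3))"
    unfolding distrib_left sum.distrib centred V using p by (simp add: sum_divide_distrib)
  also have "\<dots> \<le> Z"
    unfolding Z_def using p z by (intro sum_mono mult_left_mono exp_quadratic_bounds) auto
  finally have ZL: "1 + V / 3 \<le> Z" .
  have Z0: "Z > 0" using ZL V0 by linarith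
  have ln_eq: "ln (\<Sum>a\<in>A. p a * exp (y a)) = m + ln Z"
    unfolding split using Z0 by (simp add: ln_mult)
  have "ln Z \<le> Z - 1" using Z0 by (rule ln_le_minus_one)
  then show ?U using ZU unfolding ln_eq V_def m_def by linarith
  \<comment> \<open>Lowering the coefficient from 1/3 to 1/4 pays for the quadratic error of the
    logarithm.\<close>
  have "V * V \<le> V * (1 / 100)" using V0 V1 by (intro mult_left_mono) auto
  then have "V / 4 \<le> V / 3 - (V / 3)\<^sup>2" using V0 by (simp add: power2_eq_square)
  also have "\<dots> \<le> ln (1 + V / 3)" using V0 V1 by (intro ln_one_plus_pos_lower_bound) auto
  also have "\<dots> \<le> ln Z" using ZL V0 by (intro ln_mono) auto
  finally show ?L unfolding ln_eq V_def m_def by linarith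
qed

section \<open>Strategies and expected losses along the play\<close>

locale oh_play =
  fixes n :: nat and d :: "nat \<Rightarrow> nat" and loss :: "nat \<Rightarrow> (nat \<Rightarrow> nat) \<Rightarrow> real"
    and \<eta> :: real and x :: "nat \<Rightarrow> nat \<Rightarrow> nat \<Rightarrow> real"
  assumes n: "n \<ge> 1" and game: "finite_game n d loss" and \<eta>_pos: "\<eta> > 0"
    and play: "optimistic_hedge n d loss \<eta> x"
begin

abbreviation lv :: "nat \<Rightarrow> nat \<Rightarrow> nat \<Rightarrow> real" where
  "lv \<equiv> loss_vec n d loss x"

lemma finite_actions [simp]: "finite (actions d i)"
  by (simp add: actions_def)

lemma actions_nonempty: "i \<in> {1..n} \<Longrightarrow> actions d i \<noteq> {}"
  using game by (auto simp: finite_game_def actions_def)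

lemma card_actions [simp]: "card (actions d i) = d i"
  by (simp add: actions_def)

lemma x_initial: "i \<in> {1..n} \<Longrightarrow> a \<in> actions d i \<Longrightarrow> x 1 i a = 1 / real (d i)"
  using play by (simp add: optimistic_hedge_def)

lemma x_Suc:
  assumes "t \<ge> 1" "i \<in> {1..n}" "a \<in> actions d i"
  shows "x (Suc t) i a = x t i a * exp (- \<eta> * (2 * lv t i a - lv (t - 1) i a))
    / (\<Sum>b\<in>actions d i. x t i b * exp (- \<eta> * (2 * lv t i b - lv (t - 1) i b)))"
  using play assms unfolding optimistic_hedge_def oh_weight_def Suc_eq_plus1 by blast

lemma x_distribution:
  assumes "t \<ge> 1" "i \<in> {1..n}"
  shows "(\<forall>a\<in>actions d i. x t i a > 0) \<and> (\<Sum>a\<in>actions d i. x t i a) = 1"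
  using assms(1)
proof (induction t rule: dec_induct)
  case base
  have "d i \<ge> 1" using game assms by (auto simp: finite_game_def)
  then show ?case using x_initial[OF assms(2)] by simp
next
  case (step t)
  define N where "N = (\<Sum>b\<in>actions d i. x t i b * exp (- \<eta> * (2 * lv t i b - lv (t - 1) i b)))"
  have "N > 0"
    unfolding N_def using step actions_nonempty[OF assms(2)] by (intro sum_pos) auto
  moreover have "x (Suc t) i a = x t i a * exp (- \<eta> * (2 * lv t i a - lv (t - 1) i a)) / N"
    if "a \<in> actions d i" for a
    unfolding N_def using x_Suc[OF _ assms(2) that] step by simp
  ultimately show ?case
    using step by (auto simp: N_def simp flip: sum_divide_distrib)
qed

lemma x_pos: "t \<ge> 1 \<Longrightarrow> i \<in> {1..n} \<Longrightarrow> a \<in> actions d i \<Longrightarrow> x t i a > 0"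
  using x_distribution by blast

lemma x_sum: "t \<ge> 1 \<Longrightarrow> i \<in> {1..n} \<Longrightarrow> (\<Sum>a\<in>actions d i. x t i a) = 1"
  using x_distribution by blast

lemma opp_profile_action: "q \<in> opp_profiles n d i \<Longrightarrow> j \<in> {1..n} - {i} \<Longrightarrow> q j \<in> actions d j"
  unfolding opp_profiles_def by (rule PiE_mem)

lemma opp_profile_weight_sum:
  assumes "t \<ge> 1"
  shows "(\<Sum>q\<in>opp_profiles n d i. \<Prod>j\<in>{1..n} - {i}. x t j (q j)) = 1"
proof -
  have "(\<Sum>q\<in>opp_profiles n d i. \<Prod>j\<in>{1..n} - {i}. x t j (q j))
      = (\<Prod>j\<in>{1..n} - {i}. \<Sum>a\<in>actions d j. x t j a)"
    unfolding opp_profiles_def by (rule prod_sum_PiE[symmetric]) auto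
  also have "\<dots> = 1" using x_sum[OF assms] by (intro prod.neutral) auto
  finally show ?thesis .
qed

lemma opp_profile_weight_nonneg:
  assumes "t \<ge> 1" "q \<in> opp_profiles n d i"
  shows "(\<Prod>j\<in>{1..n} - {i}. x t j (q j)) \<ge> 0"
  using opp_profile_action[OF assms(2)] x_pos[OF assms(1)] by (intro prod_nonneg) (auto intro: less_imp_le)

lemma loss_unit:
  assumes "i \<in> {1..n}" "a \<in> actions d i" "q \<in> opp_profiles n d i"
  shows "0 \<le> loss i (q(i := a))" "loss i (q(i := a)) \<le> 1"
proof -
  have "q(i := a) \<in> PiE (insert i ({1..n} - {i})) (actions d)"
    using assms unfolding opp_profiles_def by (intro PiE_fun_upd) auto
  also have "insert i ({1..n} - {i}) = {1..n}" using assms by auto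
  finally have "q(i := a) \<in> profiles n d" unfolding profiles_def .
  then show "0 \<le> loss i (q(i := a))" "loss i (q(i := a)) \<le> 1"
    using game assms(1) by (auto simp: finite_game_def)
qed

lemma lv_eq:
  "t \<ge> 1 \<Longrightarrow> lv t i a = (\<Sum>q\<in>opp_profiles n d i. loss i (q(i := a)) * (\<Prod>j\<in>{1..n} - {i}. x t j (q j)))"
  by (simp add: loss_vec_def expected_loss_def)

lemma lv_unit:
  assumes "i \<in> {1..n}" "a \<in> actions d i"
  shows "0 \<le> lv t i a" "lv t i a \<le> 1"
proof -
  let ?P = "\<lambda>q. \<Prod>j\<in>{1..n} - {i}. x t j (q j)"
  have "0 \<le> lv t i a \<and> lv t i a \<le> 1"
  proof (cases "t = 0")
    case False
    then have t: "t \<ge> 1" by simp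
    have "(\<Sum>q\<in>opp_profiles n d i. loss i (q(i := a)) * ?P q) \<le> (\<Sum>q\<in>opp_profiles n d i. 1 * ?P q)"
      by (intro sum_mono mult_right_mono loss_unit[OF assms] opp_profile_weight_nonneg[OF t])
    moreover have "0 \<le> (\<Sum>q\<in>opp_profiles n d i. loss i (q(i := a)) * ?P q)"
      by (intro sum_nonneg mult_nonneg_nonneg loss_unit[OF assms] opp_profile_weight_nonneg[OF t])
    ultimately show ?thesis using opp_profile_weight_sum[OF t] by (simp add: lv_eq[OF t])
  qed (simp add: loss_vec_def)
  then show "0 \<le> lv t i a" "lv t i a \<le> 1" by auto
qed

subsection \<open>Smoothness of the loss vectors\<close>

definition logit_change :: "nat \<Rightarrow> nat \<Rightarrow> nat \<Rightarrow> nat \<Rightarrow> real" where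
  "logit_change t i a s = (\<Sum>u<s. - \<eta> * (2 * lv (t + u) i a - lv (t + u - 1) i a))"

text \<open>The normalisers of the single rounds cancel, so \<open>s\<close> rounds amount to one
  softmax reweighting of \<open>x t i\<close>. This gives \<open>maj_softmax_ratio\<close> a fixed
  base distribution.\<close>

lemma x_shift:
  assumes t: "t \<ge> 1" and i: "i \<in> {1..n}" and a: "a \<in> actions d i"
  shows "x (t + s) i a = x t i a *
    (exp (logit_change t i a s) / (\<Sum>b\<in>actions d i. x t i b * exp (logit_change t i b s)))"
  using a
proof (induction s arbitrary: a)
  case 0
  then show ?case using x_sum[OF t i] by (simp add: logit_change_def)
next
  case (Suc s)
  define Z where "Z s = (\<Sum>b\<in>actions d i. x t i b * exp (logit_change t i b s))" for s
  have Z: "Z s > 0" for s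
    unfolding Z_def using actions_nonempty[OF i] x_pos[OF t i] by (intro sum_pos) auto
  let ?g = "\<lambda>b. exp (- \<eta> * (2 * lv (t + s) i b - lv (t + s - 1) i b))"
  have upd: "x (t + s) i b * ?g b = x t i b * exp (logit_change t i b (Suc s)) / Z s" if "b \<in> actions d i" for b
    using Suc.IH[OF that] by (simp add: logit_change_def Z_def exp_add[symmetric])
  have "x (t + Suc s) i a = x (t + s) i a * ?g a / (\<Sum>b\<in>actions d i. x (t + s) i b * ?g b)"
    using x_Suc[of "t + s" i a] t i Suc.prems by simp
  also have "\<dots> = (x t i a * exp (logit_change t i a (Suc s)) / Z s)
      / (\<Sum>b\<in>actions d i. x t i b * exp (logit_change t i b (Suc s)) / Z s)"
    using upd Suc.prems by (simp cong: sum.cong)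
  also have "\<dots> = x t i a * (exp (logit_change t i a (Suc s)) / Z (Suc s))"
    using Z[of s] by (simp add: Z_def[of "Suc s"] flip: sum_divide_distrib)
  finally show ?case by (simp add: Z_def)
qed

text \<open>The radius of the Cauchy majorants. The constant is \<open>960 = 10 * 96\<close>, where
  \<open>96 = 24 * 4\<close> collects the losses in \<open>maj_logit_change\<close> and 10 the loss
  of the softmax.\<close>

definition rad :: real where
  "rad = 1 / (960 * sqrt (real n) * \<eta>)"

lemma rad_pos: "rad > 0"
  using n \<eta>_pos by (simp add: rad_def)

text \<open>Logits are sums of losses, so a difference of positive order is a loss difference of one
  order less, to which the induction hypothesis applies. At order 0 the bound comes from the window
  length, at most \<open>4 * rad\<close>.\<close>

lemma maj_logit_change:
  assumes IH: "\<And>m t. m < k \<Longrightarrow> t \<ge> m + 1 \<Longrightarrow> \<bar>fd m (\<lambda>t. lv t i a) t\<bar> \<le> 8 * bw rad m"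
    and k: "real k \<le> 4 * rad" and t: "t \<ge> k + 1" and i: "i \<in> {1..n}" and a: "a \<in> actions d i"
  shows "maj rad k (1 / (10 * sqrt (real n))) (logit_change t i a)"
proof (rule majI)
  fix l s assume ls: "l + s \<le> k"
  show "\<bar>fd l (logit_change t i a) s\<bar> \<le> 1 / (10 * sqrt (real n)) * bw rad l"
  proof (cases l)
    case 0
    have "\<bar>logit_change t i a s\<bar> \<le> (\<Sum>u<s. \<eta> * 3)"
      unfolding logit_change_def
    proof (rule order_trans[OF sum_abs], rule sum_mono)
      fix u
      have "\<bar>2 * lv (t + u) i a - lv (t + u - 1) i a\<bar> \<le> 3"
        using lv_unit[OF i a, of "t + u"] lv_unit[OF i a, of "t + u - 1"] by linarith
      then show "\<bar>- \<eta> * (2 * lv (t + u) i a - lv (t + u - 1) i a)\<bar> \<le> \<eta> * 3"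
        using \<eta>_pos by (simp add: abs_mult)
    qed
    also have "\<dots> = real s * (\<eta> * 3)" by simp
    also have "\<dots> \<le> (4 * rad) * (\<eta> * 3)"
      using ls k \<eta>_pos by (intro mult_right_mono) auto
    also have "\<dots> = 1 / (10 * sqrt (real n)) * bw rad 0"
      using \<eta>_pos n by (simp add: rad_def bw_def field_simps)
    finally show ?thesis using 0 by simp
  next
    case (Suc m)
    \<comment> \<open>The optimistic correction brings in the round before \<open>t\<close>. The
      hypothesis still covers it because \<open>t' \<ge> k \<ge> m + 1\<close>.\<close>
    define t' where "t' = t - 1"
    have t': "t = Suc t'" using t by (simp add: t'_def)
    have "fd l (logit_change t i a) s = fd m (\<lambda>u. - \<eta> * (2 * lv (t + u) i a - lv (t' + u) i a)) s"
      by (simp only: Suc fd_Suc') (simp add: logit_change_def t')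
    also have "\<dots> = - \<eta> * (2 * fd m (\<lambda>t. lv t i a) (t + s) - fd m (\<lambda>t. lv t i a) (t' + s))"
      unfolding fd_cmult fd_diff fd_shift[of m "\<lambda>t. lv t i a"] ..
    finally have eq: "\<bar>fd l (logit_change t i a) s\<bar>
        = \<eta> * \<bar>2 * fd m (\<lambda>t. lv t i a) (t + s) - fd m (\<lambda>t. lv t i a) (t' + s)\<bar>"
      using \<eta>_pos by (simp add: abs_mult)
    have "\<bar>fd m (\<lambda>t. lv t i a) (t + s)\<bar> \<le> 8 * bw rad m" "\<bar>fd m (\<lambda>t. lv t i a) (t' + s)\<bar> \<le> 8 * bw rad m"
      using ls t Suc by (auto intro!: IH simp: t'_def)
    then have "\<bar>2 * fd m (\<lambda>t. lv t i a) (t + s) - fd m (\<lambda>t. lv t i a) (t' + s)\<bar> \<le> 24 * bw rad m"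
      by linarith
    also have "\<dots> \<le> 24 * (4 * rad * bw rad l)"
      unfolding Suc by (intro mult_left_mono bw_Suc_ge rad_pos) auto
    finally have "\<bar>fd l (logit_change t i a) s\<bar> \<le> \<eta> * (24 * (4 * rad * bw rad l))"
      unfolding eq using \<eta>_pos by (intro mult_left_mono) auto
    also have "\<dots> = 1 / (10 * sqrt (real n)) * bw rad l"
      using \<eta>_pos n by (simp add: rad_def field_simps)
    finally show ?thesis .
  qed
qed

lemma maj_x_ratio:
  assumes \<zeta>: "\<And>a. a \<in> actions d i \<Longrightarrow> maj rad k (1 / (10 * sqrt (real n))) (logit_change t i a)"
    and t: "t \<ge> 1" and i: "i \<in> {1..n}" and a: "a \<in> actions d i"
  shows "maj rad k (1 / sqrt (real n)) (\<lambda>s. x (t + s) i a / x t i a - 1)"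
proof -
  have "1 \<le> sqrt (real n)" using n by simp
  then have "1 / (10 * sqrt (real n)) \<le> 1 / 10" by (simp add: field_simps)
  from maj_softmax_ratio[OF rad_pos this \<zeta> less_imp_le[OF x_pos[OF t i]] x_sum[OF t i] a]
  have "maj rad k (1 / sqrt (real n)) (\<lambda>s. exp (logit_change t i a s)
      / (\<Sum>b\<in>actions d i. x t i b * exp (logit_change t i b s)) - 1)"
    by simp
  moreover have "exp (logit_change t i a s) / (\<Sum>b\<in>actions d i. x t i b * exp (logit_change t i b s))
      = x (t + s) i a / x t i a" for s
    unfolding x_shift[OF t i a, of s] using x_pos[OF t i a] by simp
  ultimately show ?thesis by simp
qed

text \<open>
  \<open>overlap t j s u\<close> is \<open>1\<close> plus the covariance, under \<open>x t j\<close>, of the relative changes of the strategy of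
  \<open>j\<close> over \<open>s\<close> and \<open>u\<close> rounds: the first-order terms vanish. This is why the constants
  multiply to \<open>(1 + 1 / n) ^ n\<close> over the players and step sizes of order \<open>1 / sqrt n\<close> suffice.
\<close>

definition overlap :: "nat \<Rightarrow> nat \<Rightarrow> nat \<Rightarrow> nat \<Rightarrow> real" where
  "overlap t j s u = (\<Sum>a\<in>actions d j. x t j a * (x (t + s) j a / x t j a * (x (t + u) j a / x t j a)))"

lemma maj2_overlap:
  assumes \<xi>: "\<And>a. a \<in> actions d j \<Longrightarrow> maj rad k (1 / sqrt (real n)) (\<lambda>s. x (t + s) j a / x t j a - 1)"
    and t: "t \<ge> 1" and j: "j \<in> {1..n}"
  shows "maj2 rad k (1 / real n) (\<lambda>s u. overlap t j s u - 1)"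
proof -
  let ?\<xi> = "\<lambda>a s. x (t + s) j a / x t j a - 1"
  have "maj2 rad k ((1 / sqrt (real n))\<^sup>2) (\<lambda>s u. \<Sum>a\<in>actions d j. x t j a * (?\<xi> a s * ?\<xi> a u))"
    using x_pos[OF t j] by (intro maj2_convex_tensor rad_pos \<xi> x_sum t j less_imp_le)
  moreover have "(\<Sum>a\<in>actions d j. x t j a * (?\<xi> a s * ?\<xi> a u)) = overlap t j s u - 1" for s u
  proof -
    have "(\<Sum>a\<in>actions d j. x t j a * (?\<xi> a s * ?\<xi> a u))
      = (\<Sum>a\<in>actions d j. x t j a * (x (t + s) j a / x t j a * (x (t + u) j a / x t j a))
          - x (t + s) j a - x (t + u) j a + x t j a)"
    proof (intro sum.cong refl)
      fix a assume "a \<in> actions d j"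
      then have "x t j a \<noteq> 0" using x_pos[OF t j] by fastforce
      then show "x t j a * (?\<xi> a s * ?\<xi> a u) = x t j a * (x (t + s) j a / x t j a * (x (t + u) j a / x t j a))
          - x (t + s) j a - x (t + u) j a + x t j a"
        by (simp add: field_simps)
    qed
    also have "\<dots> = overlap t j s u - 1"
      using x_sum[of "t + s" j] x_sum[of "t + u" j] x_sum[of t j] t j
      by (simp add: sum.distrib sum_subtractf overlap_def)
    finally show ?thesis .
  qed
  ultimately show ?thesis using n by (simp add: power_divide)
qed

text \<open>Relative to round \<open>t\<close>, later losses are averages of \<open>L\<close>
  weighted by likelihood ratios \<open>Q\<close>, so time differences fall on \<open>Q\<close>
  alone. Cauchy-Schwarz removes the loss, and the second moment of the differenced ratio is a
  diagonal mixed difference that factors over the opponents.\<close>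

lemma fd_loss_square_le:
  assumes t: "t \<ge> 1" and i: "i \<in> {1..n}" and a: "a \<in> actions d i"
  shows "(fd k (\<lambda>t. lv t i a) t)\<^sup>2 \<le> fd2 k k (\<lambda>s u. \<Prod>j\<in>{1..n} - {i}. overlap t j s u) 0 0"
proof -
  let ?J = "{1..n} - {i}" and ?O = "opp_profiles n d i"
  define P where "P q = (\<Prod>j\<in>?J. x t j (q j))" for q
  define Q where "Q q s = (\<Prod>j\<in>?J. x (t + s) j (q j) / x t j (q j))" for q s
  define L where "L q = loss i (q(i := a))" for q
  have P0: "P q \<ge> 0" if "q \<in> ?O" for q
    unfolding P_def by (rule opp_profile_weight_nonneg[OF t that])
  have PQ: "P q * Q q s = (\<Prod>j\<in>?J. x (t + s) j (q j))" if "q \<in> ?O" for q s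
  proof -
    have "x t j (q j) \<noteq> 0" if "j \<in> ?J" for j
      using x_pos[OF t _ opp_profile_action[OF \<open>q \<in> ?O\<close> that]] that by fastforce
    then show ?thesis
      unfolding P_def Q_def prod.distrib[symmetric] by (intro prod.cong) auto
  qed
  have "fd k (\<lambda>t. lv t i a) t = fd k (\<lambda>s. lv (t + s) i a) 0"
    using fd_shift[of k "\<lambda>t. lv t i a" t 0] by simp
  also have "(\<lambda>s. lv (t + s) i a) = (\<lambda>s. \<Sum>q\<in>?O. (L q * P q) * Q q s)"
  proof
    fix s
    have "t + s \<ge> 1" using t by simp
    then show "lv (t + s) i a = (\<Sum>q\<in>?O. (L q * P q) * Q q s)"
      by (simp add: lv_eq L_def PQ mult.assoc cong: sum.cong)
  qed
  also have "fd k \<dots> 0 = (\<Sum>q\<in>?O. (L q * P q) * fd k (Q q) 0)"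
    unfolding fd_sum fd_cmult ..
  finally have "\<bar>fd k (\<lambda>t. lv t i a) t\<bar> \<le> (\<Sum>q\<in>?O. \<bar>(L q * P q) * fd k (Q q) 0\<bar>)"
    by (simp only: sum_abs)
  also have "\<dots> = (\<Sum>q\<in>?O. P q * (\<bar>L q\<bar> * \<bar>fd k (Q q) 0\<bar>))"
    using P0 by (intro sum.cong) (auto simp: abs_mult)
  also have "\<dots> \<le> sqrt ((\<Sum>q\<in>?O. P q * (L q)\<^sup>2) * (\<Sum>q\<in>?O. P q * (fd k (Q q) 0)\<^sup>2))"
    by (rule weighted_Cauchy_Schwarz[OF P0])
  also have "\<dots> \<le> sqrt (1 * (\<Sum>q\<in>?O. P q * (fd k (Q q) 0)\<^sup>2))"
  proof (intro real_sqrt_le_mono mult_right_mono)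
    have "(\<Sum>q\<in>?O. P q * (L q)\<^sup>2) \<le> (\<Sum>q\<in>?O. P q * 1)"
      using P0 loss_unit[OF i a] by (intro sum_mono mult_left_mono) (auto simp: L_def power_le_one)
    then show "(\<Sum>q\<in>?O. P q * (L q)\<^sup>2) \<le> 1"
      using opp_profile_weight_sum[OF t] by (simp add: P_def)
    show "0 \<le> (\<Sum>q\<in>?O. P q * (fd k (Q q) 0)\<^sup>2)"
      using P0 by (intro sum_nonneg) auto
  qed
  finally have le: "\<bar>fd k (\<lambda>t. lv t i a) t\<bar> \<le> sqrt (\<Sum>q\<in>?O. P q * (fd k (Q q) 0)\<^sup>2)"
    by simp
  have "0 \<le> (\<Sum>q\<in>?O. P q * (fd k (Q q) 0)\<^sup>2)"
    using P0 by (intro sum_nonneg) auto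
  then have "(fd k (\<lambda>t. lv t i a) t)\<^sup>2 \<le> (\<Sum>q\<in>?O. P q * (fd k (Q q) 0)\<^sup>2)"
    using power_mono[OF le, of 2] by simp
  also have "\<dots> = fd2 k k (\<lambda>s u. \<Sum>q\<in>?O. P q * (Q q s * Q q u)) 0 0"
    unfolding fd2_sum fd2_cmult fd2_tensor power2_eq_square ..
  also have "(\<lambda>s u. \<Sum>q\<in>?O. P q * (Q q s * Q q u)) = (\<lambda>s u. \<Prod>j\<in>?J. overlap t j s u)"
  proof (intro ext)
    fix s u
    show "(\<Sum>q\<in>?O. P q * (Q q s * Q q u)) = (\<Prod>j\<in>?J. overlap t j s u)"
      unfolding overlap_def P_def Q_def opp_profiles_def prod.distrib[symmetric]
      by (rule prod_sum_PiE[symmetric]) auto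
  qed
  finally show ?thesis .
qed

text \<open>
  The restriction \<open>t \<ge> k + 1\<close> is needed since the convention for the loss of round \<open>0\<close> creates
  a jump, which costs one order of smoothness per round.
\<close>

lemma loss_smooth:
  assumes "real k \<le> 4 * rad" "t \<ge> k + 1" "i \<in> {1..n}" "a \<in> actions d i"
  shows "\<bar>fd k (\<lambda>t. lv t i a) t\<bar> \<le> 8 * bw rad k"
  using assms
proof (induction k arbitrary: t i a rule: less_induct)
  case (less k)
  show ?case
  proof (cases "k = 0")
    case True
    then show ?thesis using lv_unit[OF less.prems(3,4), of t] by (simp add: bw_def)
  next
    case False
    let ?J = "{1..n} - {i}"
    have t: "t \<ge> 1" using less.prems by simp
    have "maj rad k (1 / (10 * sqrt (real n))) (logit_change t j b)" if "j \<in> {1..n}" "b \<in> actions d j" for j b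
      using less.prems that by (intro maj_logit_change less.IH) auto
    then have ov: "maj2 rad k (1 / real n) (\<lambda>s u. overlap t j s u - 1)" if "j \<in> {1..n}" for j
      using that t by (intro maj2_overlap maj_x_ratio) auto
    have "maj2 rad k ((1 + 1 / real n) ^ card ?J - 1) (\<lambda>s u. (\<Prod>j\<in>?J. overlap t j s u) - 1)"
      by (intro maj2_prod rad_pos ov) auto
    from maj2D[OF this, of k 0 k 0]
    have "\<bar>fd2 k k (\<lambda>s u. (\<Prod>j\<in>?J. overlap t j s u) - 1) 0 0\<bar>
        \<le> ((1 + 1 / real n) ^ card ?J - 1) * (bw rad k * bw rad k)" by simp
    moreover have "fd2 k k (\<lambda>s u. (\<Prod>j\<in>?J. overlap t j s u) - 1) 0 0
        = fd2 k k (\<lambda>s u. \<Prod>j\<in>?J. overlap t j s u) 0 0"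
      using False fd2_add[of k k "\<lambda>s u. \<Prod>j\<in>?J. overlap t j s u" "\<lambda>s u. - 1" 0 0] by (simp add: fd2_const)
    \<comment> \<open>The 64 is the square of the 8 in the claim. The product is at most
      \<open>exp 1\<close> for every \<open>n\<close>, so the induction closes with the same
      constant at each order.\<close>
    moreover have "((1 + 1 / real n) ^ card ?J - 1) * (bw rad k * bw rad k) \<le> 64 * (bw rad k * bw rad k)"
    proof (rule mult_right_mono)
      have "(1 + 1 / real n) ^ card ?J \<le> exp (1 / real n) ^ card ?J"
        by (intro power_mono) (auto simp: exp_ge_add_one_self)
      also have "\<dots> \<le> exp (1 / real n) ^ n"
        using less.prems by (intro power_increasing) auto
      also have "\<dots> = exp 1" using n by (simp flip: exp_of_nat_mult)
      finally show "(1 + 1 / real n) ^ card ?J - 1 \<le> 64" using exp_le by linarith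
    qed simp
    ultimately have "(fd k (\<lambda>t. lv t i a) t)\<^sup>2 \<le> (8 * bw rad k)\<^sup>2"
      using fd_loss_square_le[OF t less.prems(3,4), of k] by (simp add: power2_eq_square)
    then show ?thesis
      using bw_nonneg[OF rad_pos, of k] abs_le_square_iff[of "fd k (\<lambda>t. lv t i a) t" "8 * bw rad k"] by simp
  qed
qed

subsection \<open>Regret in terms of variances\<close>

text \<open>The updates telescope: Optimistic Hedge is Hedge with the latest loss counted twice. The
  zero loss of round 0 makes the formula uniform at \<open>t = 0\<close>.\<close>

lemma x_eq_softmax:
  assumes i: "i \<in> {1..n}" and a: "a \<in> actions d i"
  shows "x (Suc t) i a = exp (- \<eta> * ((\<Sum>s=1..t. lv s i a) + lv t i a))
    / (\<Sum>b\<in>actions d i. exp (- \<eta> * ((\<Sum>s=1..t. lv s i b) + lv t i b)))"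
  using a
proof (induction t arbitrary: a)
  case 0
  then show ?case using x_initial[OF i] by (simp add: loss_vec_def)
next
  case (Suc t)
  define Z where "Z t = (\<Sum>b\<in>actions d i. exp (- \<eta> * ((\<Sum>s=1..t. lv s i b) + lv t i b)))" for t
  have Z: "Z t > 0" for t
    unfolding Z_def using actions_nonempty[OF i] by (intro sum_pos) auto
  have upd: "x (Suc t) i b * exp (- \<eta> * (2 * lv (Suc t) i b - lv t i b))
      = exp (- \<eta> * ((\<Sum>s=1..Suc t. lv s i b) + lv (Suc t) i b)) / Z t" if "b \<in> actions d i" for b
    unfolding Suc.IH[OF that] Z_def[symmetric] times_divide_eq_left exp_add[symmetric]
    by (simp add: algebra_simps)
  have "x (Suc (Suc t)) i a = x (Suc t) i a * exp (- \<eta> * (2 * lv (Suc t) i a - lv t i a))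
      / (\<Sum>b\<in>actions d i. x (Suc t) i b * exp (- \<eta> * (2 * lv (Suc t) i b - lv t i b)))"
    using x_Suc[of "Suc t" i a] i Suc.prems by simp
  also have "\<dots> = (exp (- \<eta> * ((\<Sum>s=1..Suc t. lv s i a) + lv (Suc t) i a)) / Z t) / (Z (Suc t) / Z t)"
    unfolding upd[OF Suc.prems] Z_def[of "Suc t"] sum_divide_distrib
    by (intro arg_cong2[where f = "(/)"] refl sum.cong upd)
  also have "\<dots> = exp (- \<eta> * ((\<Sum>s=1..Suc t. lv s i a) + lv (Suc t) i a)) / Z (Suc t)"
    using Z[of t] by simp
  finally show ?case by (simp only: Z_def)
qed

definition potential :: "nat \<Rightarrow> nat \<Rightarrow> real" where
  "potential i t = (\<Sum>a\<in>actions d i. exp (- \<eta> * (\<Sum>s=1..t. lv s i a)))"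

lemma potential_pos: "i \<in> {1..n} \<Longrightarrow> potential i t > 0"
  unfolding potential_def using actions_nonempty by (intro sum_pos) auto

text \<open>Under \<open>x (Suc t)\<close> the loss of round \<open>t\<close> is counted once too
  often. Undoing this writes the old potential with \<open>exp (\<eta> * lv t i a)\<close> and
  leaves only the prediction error in the new one.\<close>

lemma potential_ratio:
  assumes i: "i \<in> {1..n}"
  shows "potential i (Suc t) / potential i t =
    (\<Sum>a\<in>actions d i. x (Suc t) i a * exp (- \<eta> * (lv (Suc t) i a - lv t i a)))
    / (\<Sum>a\<in>actions d i. x (Suc t) i a * exp (\<eta> * lv t i a))"
proof -
  define Z where "Z = (\<Sum>b\<in>actions d i. exp (- \<eta> * ((\<Sum>s=1..t. lv s i b) + lv t i b)))"
  have Z: "Z > 0"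
    unfolding Z_def using actions_nonempty[OF i] by (intro sum_pos) auto
  have xS: "x (Suc t) i a = exp (- \<eta> * ((\<Sum>s=1..t. lv s i a) + lv t i a)) / Z" if "a \<in> actions d i" for a
    unfolding Z_def by (rule x_eq_softmax[OF i that])
  have "(\<Sum>a\<in>actions d i. x (Suc t) i a * exp (- \<eta> * (lv (Suc t) i a - lv t i a))) = potential i (Suc t) / Z"
    unfolding potential_def sum_divide_distrib
    by (intro sum.cong refl) (simp add: xS algebra_simps flip: exp_add)
  moreover have "(\<Sum>a\<in>actions d i. x (Suc t) i a * exp (\<eta> * lv t i a)) = potential i t / Z"
    unfolding potential_def sum_divide_distrib
    by (intro sum.cong refl) (simp add: xS algebra_simps flip: exp_add)
  ultimately show ?thesis using Z by simp
qed

lemma pair_var_cmult: "pair_var A p (\<lambda>a. c * f a) = c\<^sup>2 * pair_var A p f"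
  unfolding pair_var_def sum_distrib_left
  by (intro sum.cong refl) (simp add: power_mult_distrib mult_ac flip: right_diff_distrib)

definition gap :: "nat \<Rightarrow> nat \<Rightarrow> real" where
  "gap i t = pair_var (actions d i) (x (Suc t) i) (\<lambda>a. lv (Suc t) i a - lv t i a)
     - pair_var (actions d i) (x (Suc t) i) (lv t i) / 4"

text \<open>The upper log-moment bound is applied to the numerator of \<open>potential_ratio\<close>
  and the lower one to its denominator. The linear terms combine to the incurred loss, the quadratic
  ones to \<open>gap\<close>.\<close>

lemma one_step_regret:
  assumes i: "i \<in> {1..n}" and \<eta>: "\<eta> \<le> 1 / 20"
  shows "(\<Sum>a\<in>actions d i. x (Suc t) i a * lv (Suc t) i a)
    \<le> (ln (potential i t) - ln (potential i (Suc t))) / \<eta> + \<eta> * gap i t"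
proof -
  let ?A = "actions d i" and ?p = "x (Suc t) i"
  let ?f = "lv t i" and ?g = "\<lambda>a. lv (Suc t) i a - lv t i a"
  have p: "\<And>a. a \<in> ?A \<Longrightarrow> ?p a \<ge> 0" "(\<Sum>a\<in>?A. ?p a) = 1"
    using x_pos[OF _ i, of "Suc t"] x_sum[OF _ i, of "Suc t"] by (auto intro: less_imp_le)
  have pos: "(\<Sum>a\<in>?A. ?p a * exp (y a)) > 0" for y
    using x_pos[OF _ i, of "Suc t"] actions_nonempty[OF i] by (intro sum_pos) auto
  have small: "\<bar>c * y\<bar> \<le> 1 / 20" if "\<bar>c\<bar> = \<eta>" "\<bar>y\<bar> \<le> 1" for c y
    using mult_mono[of "\<bar>c\<bar>" "1 / 20" "\<bar>y\<bar>" 1] that \<eta> by (simp add: abs_mult)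
  have g: "\<bar>- \<eta> * ?g a\<bar> \<le> 1 / 20" and f: "\<bar>\<eta> * ?f a\<bar> \<le> 1 / 20" if "a \<in> ?A" for a
  proof -
    have "\<bar>?g a\<bar> \<le> 1" "\<bar>?f a\<bar> \<le> 1"
      using lv_unit[OF i that, of t] lv_unit[OF i that, of "Suc t"] by linarith+
    then show "\<bar>- \<eta> * ?g a\<bar> \<le> 1 / 20" "\<bar>\<eta> * ?f a\<bar> \<le> 1 / 20"
      using \<eta>_pos by (intro small; simp)+
  qed
  have "ln (potential i (Suc t)) - ln (potential i t) = ln (potential i (Suc t) / potential i t)"
    using potential_pos[OF i, of t] potential_pos[OF i, of "Suc t"] by (simp add: ln_div)
  also have "\<dots> = ln (\<Sum>a\<in>?A. ?p a * exp (- \<eta> * ?g a)) - ln (\<Sum>a\<in>?A. ?p a * exp (\<eta> * ?f a))"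
    unfolding potential_ratio[OF i] using pos[of "\<lambda>a. - \<eta> * ?g a"] pos[of "\<lambda>a. \<eta> * ?f a"] by (simp add: ln_div)
  also have "\<dots> \<le> ((\<Sum>a\<in>?A. ?p a * (- \<eta> * ?g a)) + pair_var ?A ?p (\<lambda>a. - \<eta> * ?g a))
      - ((\<Sum>a\<in>?A. ?p a * (\<eta> * ?f a)) + pair_var ?A ?p (\<lambda>a. \<eta> * ?f a) / 4)"
    by (intro diff_mono log_mgf_bounds p g f)
  also have "\<dots> = - \<eta> * (\<Sum>a\<in>?A. ?p a * lv (Suc t) i a) + \<eta>\<^sup>2 * gap i t"
    unfolding pair_var_cmult gap_def
    by (simp add: sum_distrib_left sum_negf sum_subtractf algebra_simps)
  finally have "\<eta> * (\<Sum>a\<in>?A. ?p a * lv (Suc t) i a) \<le> (ln (potential i t) - ln (potential i (Suc t))) + \<eta>\<^sup>2 * gap i t"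
    by simp
  then have "(\<eta> * (\<Sum>a\<in>?A. ?p a * lv (Suc t) i a)) / \<eta>
      \<le> ((ln (potential i t) - ln (potential i (Suc t))) + \<eta>\<^sup>2 * gap i t) / \<eta>"
    using \<eta>_pos by (intro divide_right_mono) auto
  then show ?thesis using \<eta>_pos by (simp add: add_divide_distrib power2_eq_square)
qed

lemma regret_le_gaps:
  assumes i: "i \<in> {1..n}" and \<eta>: "\<eta> \<le> 1 / 20"
  shows "regret n d loss x i T \<le> ln (real (d i)) / \<eta> + \<eta> * (\<Sum>t<T. gap i t)"
proof -
  let ?A = "actions d i" and ?S = "\<lambda>a. \<Sum>t=1..T. lv t i a"
  have "Min (?S ` ?A) \<in> ?S ` ?A" using actions_nonempty[OF i] by (intro Min_in) auto
  then obtain a where a: "a \<in> ?A" "Min (?S ` ?A) = ?S a" by auto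
  have "(\<Sum>t=1..T. \<Sum>a\<in>?A. x t i a * lv t i a) = (\<Sum>t<T. \<Sum>a\<in>?A. x (Suc t) i a * lv (Suc t) i a)"
    by (simp add: sum.atLeast1_atMost_eq)
  also have "\<dots> \<le> (\<Sum>t<T. (ln (potential i t) - ln (potential i (Suc t))) / \<eta> + \<eta> * gap i t)"
    by (intro sum_mono one_step_regret i \<eta>)
  also have "\<dots> = (\<Sum>t<T. ln (potential i t) - ln (potential i (Suc t))) / \<eta> + \<eta> * (\<Sum>t<T. gap i t)"
    by (simp add: sum.distrib sum_distrib_left sum_divide_distrib)
  also have "\<dots> = (ln (potential i 0) - ln (potential i T)) / \<eta> + \<eta> * (\<Sum>t<T. gap i t)"
    using sum_lessThan_telescope'[of "\<lambda>t. ln (potential i t)" T] by simp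
  also have "potential i 0 = real (d i)" by (simp add: potential_def)
  finally have 1: "(\<Sum>t=1..T. \<Sum>a\<in>?A. x t i a * lv t i a)
      \<le> (ln (real (d i)) - ln (potential i T)) / \<eta> + \<eta> * (\<Sum>t<T. gap i t)" .
  have "exp (- \<eta> * ?S a) \<le> potential i T"
    unfolding potential_def using a by (intro member_le_sum) auto
  then have "- \<eta> * ?S a \<le> ln (potential i T)"
    using potential_pos[OF i, of T] by (simp add: ln_ge_iff)
  then have "- ln (potential i T) / \<eta> \<le> ?S a"
    using \<eta>_pos by (simp add: field_simps)
  then show ?thesis
    using 1 unfolding regret_def a(2) by (simp add: diff_divide_distrib)
qed

section \<open>Slow variation of the strategies and the final regret bound\<close>

lemma x_slow:
  assumes t: "t \<ge> 1" and i: "i \<in> {1..n}" and a: "a \<in> actions d i"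
  shows "x t i a \<le> exp (3 * \<eta>) * x (Suc t) i a" "x (Suc t) i a \<le> exp (3 * \<eta>) * x t i a"
proof -
  let ?y = "\<lambda>b. - \<eta> * (2 * lv t i b - lv (t - 1) i b)"
  define N where "N = (\<Sum>b\<in>actions d i. x t i b * exp (?y b))"
  \<comment> \<open>Exponents, and hence the logarithm of the normaliser, lie between
    \<open>- 2 * \<eta>\<close> and \<open>\<eta>\<close>; their difference is at most
    \<open>3 * \<eta>\<close> in absolute value.\<close>
  have y: "- (2 * \<eta>) \<le> ?y b \<and> ?y b \<le> \<eta>" if "b \<in> actions d i" for b
  proof -
    have "2 * lv t i b - lv (t - 1) i b \<le> 2" "- 1 \<le> 2 * lv t i b - lv (t - 1) i b"
      using lv_unit[OF i that, of t] lv_unit[OF i that, of "t - 1"] by linarith+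
    then have "\<eta> * (2 * lv t i b - lv (t - 1) i b) \<le> \<eta> * 2" "\<eta> * (- 1) \<le> \<eta> * (2 * lv t i b - lv (t - 1) i b)"
      using \<eta>_pos by (intro mult_left_mono; simp)+
    then show ?thesis by simp
  qed
  have x0: "\<And>b. b \<in> actions d i \<Longrightarrow> x t i b \<ge> 0" using x_pos[OF t i] by (auto intro: less_imp_le)
  have "N \<le> (\<Sum>b\<in>actions d i. x t i b * exp \<eta>)"
    unfolding N_def using x0 y by (intro sum_mono mult_left_mono) auto
  then have N_le: "N \<le> exp \<eta>" using x_sum[OF t i] by (simp flip: sum_distrib_right)
  have "(\<Sum>b\<in>actions d i. x t i b * exp (- (2 * \<eta>))) \<le> N"
    unfolding N_def using x0 y by (intro sum_mono mult_left_mono) auto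
  then have N_ge: "exp (- (2 * \<eta>)) \<le> N" using x_sum[OF t i] by (simp flip: sum_distrib_right)
  have N: "N > 0" using N_ge exp_gt_zero[of "- (2 * \<eta>)"] by linarith
  have step: "N * x (Suc t) i a = x t i a * exp (?y a)"
    using x_Suc[OF t i a] N by (simp add: N_def)
  have xS: "x (Suc t) i a \<ge> 0" using x_pos[OF _ i a, of "Suc t"] by simp
  have "x t i a * exp (- (2 * \<eta>)) \<le> x t i a * exp (?y a)"
    using x0[OF a] y[OF a] by (intro mult_left_mono) auto
  also have "\<dots> \<le> exp \<eta> * x (Suc t) i a"
    unfolding step[symmetric] using N_le xS by (intro mult_right_mono) auto
  finally have "x t i a * exp (- (2 * \<eta>)) * exp (2 * \<eta>) \<le> exp \<eta> * x (Suc t) i a * exp (2 * \<eta>)"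
    by (intro mult_right_mono) auto
  moreover have "x t i a * exp (- (2 * \<eta>)) * exp (2 * \<eta>) = x t i a"
    by (simp add: mult.assoc flip: exp_add)
  moreover have "exp \<eta> * x (Suc t) i a * exp (2 * \<eta>) = (exp \<eta> * exp (2 * \<eta>)) * x (Suc t) i a"
    by simp
  moreover have "exp \<eta> * exp (2 * \<eta>) = exp (3 * \<eta>)"
    by (simp flip: exp_add)
  ultimately show "x t i a \<le> exp (3 * \<eta>) * x (Suc t) i a" by simp
  have "exp (- (2 * \<eta>)) * x (Suc t) i a \<le> x t i a * exp (?y a)"
    unfolding step[symmetric] using N_ge xS by (intro mult_right_mono) auto
  also have "\<dots> \<le> x t i a * exp \<eta>"
    using x0[OF a] y[OF a] by (intro mult_left_mono) auto
  finally have "exp (2 * \<eta>) * (exp (- (2 * \<eta>)) * x (Suc t) i a) \<le> exp (2 * \<eta>) * (x t i a * exp \<eta>)"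
    by (intro mult_left_mono) auto
  moreover have "exp (2 * \<eta>) * (exp (- (2 * \<eta>)) * x (Suc t) i a) = x (Suc t) i a"
    by (simp add: mult.assoc[symmetric] flip: exp_add)
  moreover have "exp (2 * \<eta>) * (x t i a * exp \<eta>) = (exp (2 * \<eta>) * exp \<eta>) * x t i a"
    by simp
  moreover have "exp (2 * \<eta>) * exp \<eta> = exp (3 * \<eta>)"
    by (simp flip: exp_add)
  ultimately show "x (Suc t) i a \<le> exp (3 * \<eta>) * x t i a" by simp
qed

text \<open>Covers the first \<open>h + 1\<close> rounds, before smoothness of order
  \<open>h\<close> is available. Their total contribution is of order \<open>\<eta> * h\<close>, a
  constant.\<close>

lemma gap_le:
  assumes i: "i \<in> {1..n}"
  shows "gap i t \<le> 2"
proof -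
  let ?A = "actions d i" and ?p = "x (Suc t) i" and ?g = "\<lambda>a. lv (Suc t) i a - lv t i a"
  have p: "?p a \<ge> 0" if "a \<in> ?A" for a using x_pos[OF _ i that, of "Suc t"] by simp
  have "pair_var ?A ?p ?g \<le> (\<Sum>z\<in>?A \<times> ?A. ?p (fst z) * ?p (snd z) / 2 * 4)"
    unfolding pair_var_def
  proof (intro sum_mono mult_left_mono)
    fix z assume z: "z \<in> ?A \<times> ?A"
    have "\<bar>?g (fst z) - ?g (snd z)\<bar> \<le> 2"
      using z lv_unit[OF i, of "fst z" t] lv_unit[OF i, of "snd z" t]
        lv_unit[OF i, of "fst z" "Suc t"] lv_unit[OF i, of "snd z" "Suc t"] by auto
    then show "(?g (fst z) - ?g (snd z))\<^sup>2 \<le> 4"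
      using abs_le_square_iff[of "?g (fst z) - ?g (snd z)" 2] by simp
  qed (use p in auto)
  also have "\<dots> = 2 * (\<Sum>a\<in>?A. \<Sum>b\<in>?A. ?p a * ?p b)"
    by (simp add: sum.cartesian_product case_prod_beta sum_distrib_left)
  also have "\<dots> = 2" using x_sum[OF _ i, of "Suc t"] by (simp flip: sum_product)
  finally have "pair_var ?A ?p ?g \<le> 2" .
  moreover have "pair_var ?A ?p (lv t i) \<ge> 0"
    unfolding pair_var_def using p by (intro sum_nonneg mult_nonneg_nonneg) auto
  ultimately show ?thesis by (simp add: gap_def)
qed

lemma regret_bound:
  assumes i: "i \<in> {1..n}" and \<eta>: "\<eta> \<le> (1 / 7680) / sqrt (real n)"
  shows "regret n d loss x i T \<le>
    ln (real (d i)) / \<eta> + 100 + 100 * \<eta> * real T * exp (- (1 / 7680) / (sqrt (real n) * \<eta>))"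
proof -
  let ?A = "actions d i"
  define h where "h = nat \<lfloor>rad / 8\<rfloor>"
  have sqrt_n: "sqrt (real n) \<ge> 1" using n by simp
  have "(1 / 7680) / sqrt (real n) \<le> 1 / 7680" using sqrt_n by (simp add: field_simps)
  then have \<eta>_small: "\<eta> \<le> 1 / 7680" using \<eta> by linarith
  have \<eta>n: "7680 * (sqrt (real n) * \<eta>) \<le> 1" using \<eta> sqrt_n by (simp add: field_simps)
  have rad8: "rad / 8 = (1 / 7680) / (sqrt (real n) * \<eta>)" by (simp add: rad_def)
  have "1 \<le> rad / 8" unfolding rad8 using \<eta>n \<eta>_pos sqrt_n by (simp add: field_simps)
  then have h1: "1 \<le> h" unfolding h_def by linarith
  have h_le: "real h \<le> rad / 8" and h_gt: "rad / 8 < real h + 1"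
    using rad_pos unfolding h_def by linarith+
  have "\<eta> * real h \<le> \<eta> * (rad / 8)" using h_le \<eta>_pos by (intro mult_left_mono) auto
  also have "\<dots> = (1 / 7680) / sqrt (real n)" unfolding rad8 using \<eta>_pos by simp
  finally have \<eta>h: "\<eta> * real h \<le> 1 / 7680" using \<open>(1 / 7680) / sqrt (real n) \<le> 1 / 7680\<close> by linarith
  \<comment> \<open>The index \<open>Suc t\<close> matches \<open>gap\<close>, where round
    \<open>t + 1\<close> weights both the loss of round \<open>t\<close> and the difference to the
    next loss.\<close>
  define w where "w t z = x (Suc t) i (fst z) * x (Suc t) i (snd z) / 2" for t and z :: "nat \<times> nat"
  define F where "F z t = lv t i (fst z) - lv t i (snd z)" for z :: "nat \<times> nat" and t
  \<comment> \<open>Differences of order up to \<open>h\<close> are controlled from round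
    \<open>h + 1\<close> on. Taking \<open>m1\<close> as a maximum makes the later range empty for
    short horizons.\<close>
  define m0 where "m0 = h + 1"
  define m1 where "m1 = max T m0"
  have x0: "x (Suc t) i a \<ge> 0" if "a \<in> ?A" for a t using x_pos[OF _ i that, of "Suc t"] by simp
  have "6 * \<eta> \<le> 1" using \<eta>_small by simp
  then have "exp (6 * \<eta>) \<le> 1 + 6 * \<eta> + (6 * \<eta>)\<^sup>2" using \<eta>_pos by (intro exp_bound) auto
  also have "(6 * \<eta>)\<^sup>2 \<le> 6 * \<eta>" unfolding power2_eq_square using \<open>6 * \<eta> \<le> 1\<close> \<eta>_pos by (intro mult_left_le) auto
  finally have exp6: "exp (6 * \<eta>) \<le> 1 + 12 * \<eta>" by simp
  have w0: "w t z \<ge> 0" if "z \<in> ?A \<times> ?A" for t z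
    using that x0 by (auto simp: w_def)
  have w_step: "w t z \<le> (1 + 12 * \<eta>) * w (Suc t) z" "w (Suc t) z \<le> (1 + 12 * \<eta>) * w t z"
    if "z \<in> ?A \<times> ?A" for t z
  proof -
    have z: "fst z \<in> ?A" "snd z \<in> ?A" using that by auto
    have e: "exp (3 * \<eta>) * u * (exp (3 * \<eta>) * v) / 2 = exp (6 * \<eta>) * (u * v / 2)" for u v :: real
      by (simp flip: exp_add add: mult_ac)
    have "w t z \<le> exp (3 * \<eta>) * x (Suc (Suc t)) i (fst z) * (exp (3 * \<eta>) * x (Suc (Suc t)) i (snd z)) / 2"
      unfolding w_def using z by (intro divide_right_mono mult_mono x_slow i mult_nonneg_nonneg x0) auto
    also have "\<dots> = exp (6 * \<eta>) * w (Suc t) z" unfolding w_def e ..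
    also have "\<dots> \<le> (1 + 12 * \<eta>) * w (Suc t) z" by (intro mult_right_mono exp6 w0 that)
    finally show "w t z \<le> (1 + 12 * \<eta>) * w (Suc t) z" .
    have "w (Suc t) z \<le> exp (3 * \<eta>) * x (Suc t) i (fst z) * (exp (3 * \<eta>) * x (Suc t) i (snd z)) / 2"
      unfolding w_def using z by (intro divide_right_mono mult_mono x_slow i mult_nonneg_nonneg x0) auto
    also have "\<dots> = exp (6 * \<eta>) * w t z" unfolding w_def e ..
    also have "\<dots> \<le> (1 + 12 * \<eta>) * w t z" by (intro mult_right_mono exp6 w0 that)
    finally show "w (Suc t) z \<le> (1 + 12 * \<eta>) * w t z" .
  qed
  interpret slow_weights "?A \<times> ?A" w F m0 m1 h \<eta>
  proof
    show "finite (?A \<times> ?A)" by simp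
    show "m0 \<le> m1" by (simp add: m1_def)
    show "0 < \<eta>" "1 \<le> h" by (fact \<eta>_pos, fact h1)
    show "84 * (\<eta> * real h) \<le> 1" using \<eta>h by simp
  next
    fix t z assume z: "z \<in> ?A \<times> ?A"
    show "0 \<le> w t z" by (rule w0[OF z])
    show "w t z \<le> (1 + 12 * \<eta>) * w (Suc t) z" by (rule w_step[OF z])
    show "\<bar>w (Suc t) z - w t z\<bar> \<le> 12 * \<eta> * w (Suc t) z"
    proof (cases "w t z \<le> w (Suc t) z")
      case True
      then have "12 * \<eta> * w t z \<le> 12 * \<eta> * w (Suc t) z" using \<eta>_pos by (intro mult_left_mono) auto
      then show ?thesis using True w_step(2)[OF z, of t] by (simp add: algebra_simps)
    next
      case False
      then show ?thesis using w_step(1)[OF z, of t] by (simp add: algebra_simps)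
    qed
  next
    fix t
    have "(\<Sum>z\<in>?A \<times> ?A. w t z) = (\<Sum>a\<in>?A. \<Sum>b\<in>?A. x (Suc t) i a * x (Suc t) i b) / 2"
      by (simp add: w_def sum.cartesian_product case_prod_beta sum_divide_distrib)
    also have "\<dots> = 1 / 2" using x_sum[OF _ i, of "Suc t"] by (simp flip: sum_product)
    finally show "(\<Sum>z\<in>?A \<times> ?A. w t z) \<le> 1" by simp
  next
    fix k t z assume k: "k \<le> h" and t: "m0 \<le> t" and z: "z \<in> ?A \<times> ?A"
    have F: "\<bar>fd k (\<lambda>t. lv t i a) t\<bar> \<le> (1 / 8) ^ k" if "a \<in> ?A" for a
    proof -
      have "real k \<le> 4 * rad" using k h_le rad_pos by linarith
      then have "\<bar>fd k (\<lambda>t. lv t i a) t\<bar> \<le> 8 * bw rad k"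
        using that k t i by (intro loss_smooth) (auto simp: m0_def)
      also have "\<dots> \<le> (1 / 8) ^ k" using h_le by (intro bw_le_power[OF rad_pos k]) auto
      finally show ?thesis .
    qed
    have "F z = (\<lambda>t. lv t i (fst z) - lv t i (snd z))" by (simp add: F_def fun_eq_iff)
    then have "fd k (F z) t = fd k (\<lambda>t. lv t i (fst z)) t - fd k (\<lambda>t. lv t i (snd z)) t"
      by (simp only: fd_diff)
    moreover have "fst z \<in> ?A" "snd z \<in> ?A" using z by auto
    ultimately show "\<bar>fd k (F z) t\<bar> \<le> 2 * (1 / 8) ^ k"
      using F[of "fst z"] F[of "snd z"] by linarith
  qed
  have e1: "energy 1 = (\<Sum>t=m0..<m1. pair_var ?A (x (Suc t) i) (\<lambda>a. lv (Suc t) i a - lv t i a))"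
    unfolding energy_def pair_var_def sum.cartesian_product
    by (intro sum.cong refl) (simp add: w_def F_def case_prod_beta algebra_simps)
  have e0: "energy 0 = (\<Sum>t=m0..<m1. pair_var ?A (x (Suc t) i) (lv t i))"
    unfolding energy_def pair_var_def sum.cartesian_product 
    by (intro sum.cong refl) (simp add: w_def F_def case_prod_beta)
  have gaps: "(\<Sum>t=m0..<m1. gap i t) = energy 1 - energy 0 / 4"
    unfolding e0 e1 gap_def by (simp add: sum_subtractf sum_divide_distrib)
  have "(\<Sum>t<T. gap i t) \<le> (\<Sum>t<m0. 2) + (\<Sum>t=m0..<m1. gap i t)"
  proof (cases "T \<le> m0")
    case True
    have "(\<Sum>t<T. gap i t) \<le> (\<Sum>t<T. 2)" by (intro sum_mono gap_le i)
    also have "\<dots> \<le> (\<Sum>t<m0. 2)" using True by simp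
    finally show ?thesis using True by (simp add: m1_def)
  next
    case False
    then have "(\<Sum>t<T. gap i t) = (\<Sum>t<m0. gap i t) + (\<Sum>t=m0..<m1. gap i t)"
      by (simp add: m1_def lessThan_atLeast0 sum.atLeastLessThan_concat)
    moreover have "(\<Sum>t<m0. gap i t) \<le> (\<Sum>t<m0. 2)" by (intro sum_mono gap_le i)
    ultimately show ?thesis by simp
  qed
  also have "\<dots> \<le> 2 * (real h + 1) + (24 / \<eta> + 30 * (real (m1 - m0) * exp (- real h)))"
    unfolding gaps using first_difference_energy by (simp add: m0_def)
  also have "\<dots> \<le> 2 * (real h + 1) + (24 / \<eta> + 30 * (real T * (3 * exp (- (rad / 8)))))"
  proof -
    \<comment> \<open>Rounding \<open>rad / 8\<close> down costs a factor
      \<open>exp 1 \<le> 3\<close>, and \<open>30 * 3 = 90\<close> fits below 100.\<close>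
    have "exp (- real h) \<le> exp (1 - rad / 8)" using h_gt by simp
    also have "\<dots> = exp 1 * exp (- (rad / 8))" by (simp flip: exp_add)
    also have "\<dots> \<le> 3 * exp (- (rad / 8))" using exp_le by (intro mult_right_mono) auto
    finally have "real (m1 - m0) * exp (- real h) \<le> real T * (3 * exp (- (rad / 8)))"
      by (intro mult_mono) (auto simp: m1_def)
    then show ?thesis by simp
  qed
  finally have "\<eta> * (\<Sum>t<T. gap i t)
      \<le> \<eta> * (2 * (real h + 1) + (24 / \<eta> + 30 * (real T * (3 * exp (- (rad / 8))))))"
    using \<eta>_pos by (intro mult_left_mono) auto
  also have "\<dots> = 2 * (\<eta> * real h) + 2 * \<eta> + 24 + 90 * (\<eta> * real T * exp (- (rad / 8)))"
    using \<eta>_pos by (simp add: algebra_simps)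
  also have "\<dots> \<le> 100 + 100 * (\<eta> * real T * exp (- (rad / 8)))"
    using \<eta>h \<eta>_small \<eta>_pos by (intro add_mono mult_right_mono) auto
  finally have "\<eta> * (\<Sum>t<T. gap i t) \<le> 100 + 100 * \<eta> * real T * exp (- (1 / 7680) / (sqrt (real n) * \<eta>))"
    unfolding rad8 by (simp add: mult.assoc)
  moreover have "\<eta> \<le> 1 / 20" using \<eta>_small by simp
  ultimately show ?thesis using regret_le_gaps[OF i, of T] by simp
qed

end

theorem theorem4p1:
  shows "\<exists>c0 c1 C :: real. c0 > 0 \<and> c1 > 0 \<and> C > 0 \<and>
    (\<forall>(n::nat) (d :: nat \<Rightarrow> nat) (loss :: nat \<Rightarrow> (nat \<Rightarrow> nat) \<Rightarrow> real) (T::nat) (\<eta>::real)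
       (x :: nat \<Rightarrow> nat \<Rightarrow> nat \<Rightarrow> real).
       n \<ge> 1 \<longrightarrow> finite_game n d loss \<longrightarrow> T \<ge> 1 \<longrightarrow> 0 < \<eta> \<longrightarrow> \<eta> \<le> c0 / sqrt (real n) \<longrightarrow>
       optimistic_hedge n d loss \<eta> x \<longrightarrow>
       (\<forall>i\<in>{1..n}. regret n d loss x i T \<le>
          ln (real (d i)) / \<eta> + C + C * \<eta> * real T * exp (- c1 / (sqrt (real n) * \<eta>))))"
proof (rule exI[of _ "1 / 7680"], rule exI[of _ "1 / 7680"], rule exI[of _ 100], intro conjI allI impI ballI)
  fix n d loss T i and \<eta> :: real and x
  assume "n \<ge> 1" "finite_game n d loss" "0 < \<eta>" "\<eta> \<le> 1 / 7680 / sqrt (real n)"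
    "optimistic_hedge n d loss \<eta> x" "i \<in> {1..n}"
  then interpret oh_play n d loss \<eta> x by unfold_locales
  show "regret n d loss x i T \<le> ln (real (d i)) / \<eta> + 100
      + 100 * \<eta> * real T * exp (- (1 / 7680) / (sqrt (real n) * \<eta>))"
    by (rule regret_bound) fact+
qed auto

end
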